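(* Let $G=A_n$ with $n\ge 4$ and let $M\subseteq G$ be any set of non-real elements. Then there exists an irreducible character of $G$ that vanishes on all elements of $M$. Furthermore, if $M$ is nonempty and $G$-invariant, then $H=M\cup M^{-1}$ is a connecting set and the Cayley graph $\mathrm{Cay}(G,H)$ is singular.
   Context: An element $g$ is real if $g^{-1}$ is conjugate to $g$ in $G$. $G$-invariant means a union of conjugacy classes. A connecting set of $G$ is a subset $H$ with $1\notin H$, $H=H^{-1}$, and $H$ generating $G$. The Cayley graph $\mathrm{Cay}(G,H)$ has vertex set $G$, with distinct $u,v$ adjacent iff $hu=v$ for some $h\in H$. A graph is singular if its adjacency matrix is singular. *)

theory Defs
  imports
    "HOL-Algebra.Sym_Groups"
    "HOL-Algebra.Group_Action"
    "Jordan_Normal_Form.VS_Connect"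
    "Graph_Theory.Pair_Digraph"
begin

section \<open>Conjugacy and real elements\<close>

definition conj_class :: "('a, 'b) monoid_scheme \<Rightarrow> 'a \<Rightarrow> 'a set" where
  "conj_class G x =
     orbit G (\<lambda>g. \<lambda>h \<in> carrier G. g \<otimes>\<^bsub>G\<^esub> h \<otimes>\<^bsub>G\<^esub> inv\<^bsub>G\<^esub> g) x"

definition real_element :: "('a, 'b) monoid_scheme \<Rightarrow> 'a \<Rightarrow> bool" where
  "real_element G g \<longleftrightarrow> g \<in> carrier G \<and> inv\<^bsub>G\<^esub> g \<in> conj_class G g"

definition conj_invariant :: "('a, 'b) monoid_scheme \<Rightarrow> 'a set \<Rightarrow> bool" where
  "conj_invariant G M \<longleftrightarrow> (\<exists>X \<subseteq> carrier G. M = (\<Union>x\<in>X. conj_class G x))"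


section \<open>Irreducible complex characters\<close>

text \<open>
  The dimension of a representation must range over all natural numbers inside a formula, so
  matrices with explicit dimensions are used; \<open>GL d\<close> is the group of invertible complex
  \<open>d \<times> d\<close> matrices.
\<close>

definition GL :: "nat \<Rightarrow> complex mat monoid" where
  "GL d = units_of (ring_mat TYPE(complex) d ())"

definition invariant_subspace ::
    "('a, 'b) monoid_scheme \<Rightarrow> nat \<Rightarrow> ('a \<Rightarrow> complex mat) \<Rightarrow> complex vec set \<Rightarrow> bool" where
  "invariant_subspace G d \<rho> W \<longleftrightarrow>
     VectorSpace.subspace class_ring W (module_vec TYPE(complex) d) \<and>
     (\<forall>g \<in> carrier G. \<forall>w \<in> W. \<rho> g *\<^sub>v w \<in> W)"

definition irreducible_representation ::
    "('a, 'b) monoid_scheme \<Rightarrow> nat \<Rightarrow> ('a \<Rightarrow> complex mat) \<Rightarrow> bool" where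
  "irreducible_representation G d \<rho> \<longleftrightarrow>
     \<rho> \<in> hom G (GL d) \<and> 0 < d \<and>
     (\<forall>W. invariant_subspace G d \<rho> W \<longrightarrow> W = {0\<^sub>v d} \<or> W = carrier_vec d)"

definition mat_trace :: "'a :: comm_monoid_add mat \<Rightarrow> 'a" where
  "mat_trace A = (\<Sum>i<dim_row A. A $$ (i, i))"

text \<open>
  A character is a function on the group only: it is fixed to \<^const>\<open>undefined\<close> outside
  the carrier.
\<close>

definition irreducible_character ::
    "('a, 'b) monoid_scheme \<Rightarrow> ('a \<Rightarrow> complex) \<Rightarrow> bool" where
  "irreducible_character G \<chi> \<longleftrightarrow>
     (\<exists>d \<rho>. irreducible_representation G d \<rho> \<and> \<chi> = (\<lambda>g \<in> carrier G. mat_trace (\<rho> g)))"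


section \<open>Cayley graphs and singular graphs\<close>

definition connecting_set :: "('a, 'b) monoid_scheme \<Rightarrow> 'a set \<Rightarrow> bool" where
  "connecting_set G H \<longleftrightarrow>
     H \<subseteq> carrier G \<and> \<one>\<^bsub>G\<^esub> \<notin> H \<and> H = set_inv\<^bsub>G\<^esub> H \<and> generate G H = carrier G"

text \<open>
  An undirected graph is a symmetric digraph: each edge is a pair of opposite arcs.
\<close>

definition cayley_graph :: "('a, 'b) monoid_scheme \<Rightarrow> 'a set \<Rightarrow> 'a pair_pre_digraph" where
  "cayley_graph G H =
     \<lparr> pverts = carrier G,
       parcs = {(u, v). u \<in> carrier G \<and> v \<in> carrier G \<and> u \<noteq> v \<and>
                        (\<exists>h\<in>H. h \<otimes>\<^bsub>G\<^esub> u = v)} \<rparr>"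

lemma (in group) pair_graph_cayley_graph:
  assumes fin: "finite (carrier G)" and H: "connecting_set G H"
  shows "pair_graph (cayley_graph G H)"
proof -
  have "(v, u) \<in> parcs (cayley_graph G H)" if uv: "(u, v) \<in> parcs (cayley_graph G H)" for u v
  proof -
    obtain h where h: "h \<in> H" "h \<otimes> u = v" "u \<in> carrier G" "v \<in> carrier G" "u \<noteq> v"
      using uv by (auto simp: cayley_graph_def)
    have hG: "h \<in> carrier G" and "inv h \<in> set_inv H"
      using H h(1) by (auto simp: connecting_set_def SET_INV_def)
    then have "inv h \<in> H" using H by (auto simp: connecting_set_def)
    moreover have "inv h \<otimes> v = u" using h hG by (auto simp: m_assoc[symmetric])
    ultimately show ?thesis using h by (auto simp: cayley_graph_def)
  qed
  then have sym: "symmetric (with_proj (cayley_graph G H))"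
    by (auto simp: symmetric_def sym_def)
  have "parcs (cayley_graph G H) \<subseteq> carrier G \<times> carrier G"
    by (auto simp: cayley_graph_def)
  then have "finite (parcs (cayley_graph G H))"
    using fin by (meson finite_SigmaI finite_subset)
  with sym fin show ?thesis
    by unfold_locales (auto simp: cayley_graph_def)
qed

text \<open>
  An adjacency matrix depends on an enumeration \<open>vs\<close> of the vertices; whether it is
  singular does not.
\<close>

definition adjacency_matrix :: "'a pair_pre_digraph \<Rightarrow> 'a list \<Rightarrow> real mat" where
  "adjacency_matrix \<Gamma> vs =
     Matrix.mat (length vs) (length vs) (\<lambda>(i, j). if (vs ! i, vs ! j) \<in> parcs \<Gamma> then 1 else 0)"

definition singular_graph :: "'a pair_pre_digraph \<Rightarrow> bool" where
  "singular_graph \<Gamma> \<longleftrightarrow>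
     finite (pverts \<Gamma>) \<and>
     (\<forall>vs. distinct vs \<and> set vs = pverts \<Gamma> \<longrightarrow> \<not> invertible_mat (adjacency_matrix \<Gamma> vs))"

end

theory Submission
  imports Defs "Jordan_Normal_Form.Spectral_Radius"
begin

text \<open>
  If \<open>g\<close> is non-real in the alternating group, no odd permutation commutes with \<open>g\<close>, since every
  permutation is conjugate to its inverse in the symmetric group. Hence \<open>g\<close> has at most one fixed
  point, at most one 3-cycle, and no 2-cycle or 4-cycle. For \<open>n \<ge> 7\<close> the character of the partition
  \<open>(n - 4, 3, 1)\<close> is, by Jacobi--Trudi, an alternating sum of four permutation characters on
  3-colourings of \<open>{1..n}\<close>, and on such \<open>g\<close> these cancel. It is irreducible on the alternating group
  because its norm is 1, which by Burnside's lemma amounts to counting orbits on pairs of colourings,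
  that is, \<open>3 \<times> 3\<close> contingency tables. The cases \<open>n = 4, 5, 6\<close> are treated in the same way with the
  partitions \<open>(3, 1)\<close>, \<open>(3, 2)\<close>, \<open>(3, 3)\<close>.

  If \<open>\<rho>\<close> affords this character then, by Schur's lemma, \<open>\<Sum>h\<in>H. \<rho> h\<close> is a scalar matrix of trace 0,
  so a matrix coefficient of \<open>\<rho>\<close> is a kernel vector of the adjacency matrix. Finally, a normal
  subgroup containing \<open>g\<close> contains a 3-cycle and hence is the whole group.
\<close>

section \<open>Matrix representations\<close>

text \<open>A colouring is fixed by \<open>g\<close> exactly when each colour class is a union of
  cycles. A non-real \<open>g\<close> has no invariant set of size 2, which kills the terms with two
  points of colour 1, and an invariant 4-set must be a fixed point plus a 3-cycle, so recolouring
  the unique fixed point matches the terms for sizes 3, 1 with those for size 4. For n < 7 the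
  sequence (n - 4, 3, 1) is not a partition, whence the separate shapes. Irreducibility is not
  imported from the symmetric group. The alternating sum is an integer combination of irreducible
  characters of the alternating group, and norm 1 makes it one of them up to sign, which does not
  affect zeros. The obstacle is that Burnside's lemma must count orbits of the alternating group,
  whereas contingency tables classify orbits of the symmetric group. The two agree on a pair of
  colourings once two points have equal colours in both: exchanging them is an odd permutation
  fixing the pair. The table counts are constant from n = 8 on, so finitely many evaluations settle
  all n.\<close>

definition mat_rep :: "('a, 'b) monoid_scheme \<Rightarrow> nat \<Rightarrow> ('a \<Rightarrow> complex mat) \<Rightarrow> bool" where
  "mat_rep G d \<rho> \<longleftrightarrow>
     (\<forall>g \<in> carrier G. \<rho> g \<in> carrier_mat d d) \<and> \<rho> \<one>\<^bsub>G\<^esub> = 1\<^sub>m d \<and>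
     (\<forall>g \<in> carrier G. \<forall>h \<in> carrier G. \<rho> (g \<otimes>\<^bsub>G\<^esub> h) = \<rho> g * \<rho> h)"

text \<open>The matrix \<open>\<rho> (inv g)\<close> inverts \<open>\<rho> g\<close>, so
  multiplicativity and the value at \<open>\<one>\<close> already force the image into the
  units.\<close>

lemma (in group) hom_GL_iff_mat_rep: "\<rho> \<in> hom G (GL d) \<longleftrightarrow> mat_rep G d \<rho>"
proof
  interpret R: ring "ring_mat TYPE(complex) d ()" by (rule ring_mat)
  have GL: "group (GL d)" unfolding GL_def by (rule R.units_group)
  assume hom: "\<rho> \<in> hom G (GL d)"
  have "\<rho> \<one> = \<one>\<^bsub>GL d\<^esub>" by (rule hom_one[OF hom is_group GL])
  with hom show "mat_rep G d \<rho>"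
    by (auto simp: mat_rep_def GL_def hom_def units_of_def Units_def ring_mat_def)
next
  assume rep: "mat_rep G d \<rho>"
  have "\<rho> g \<in> Units (ring_mat TYPE(complex) d ())" if g: "g \<in> carrier G" for g
  proof -
    have "\<rho> (inv g) * \<rho> g = 1\<^sub>m d" "\<rho> g * \<rho> (inv g) = 1\<^sub>m d"
      using rep g unfolding mat_rep_def by (metis inv_closed l_inv r_inv)+
    then show ?thesis
      using rep g by (auto simp: Units_def ring_mat_def mat_rep_def)
  qed
  with rep show "\<rho> \<in> hom G (GL d)"
    by (auto simp: mat_rep_def GL_def hom_def units_of_def ring_mat_def)
qed

lemma invariant_subspaceI:
  assumes "W \<subseteq> carrier_vec d" "0\<^sub>v d \<in> W"
    and "\<And>v w. v \<in> W \<Longrightarrow> w \<in> W \<Longrightarrow> v + w \<in> W" "\<And>c v. v \<in> W \<Longrightarrow> c \<cdot>\<^sub>v v \<in> W"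
    and "\<And>g w. g \<in> carrier G \<Longrightarrow> w \<in> W \<Longrightarrow> \<rho> g *\<^sub>v w \<in> W"
  shows "invariant_subspace G d \<rho> W"
  unfolding invariant_subspace_def VectorSpace.subspace_def LinearCombinations.submodule_def
  using assms vec_vs[where ?'a = complex, of d] vec_module[where ?'a = complex, of d]
  by (auto simp: module_vec_def)

lemma invariant_subspaceD:
  assumes "invariant_subspace G d \<rho> W"
  shows "W \<subseteq> carrier_vec d" "0\<^sub>v d \<in> W"
    and "\<And>v w. v \<in> W \<Longrightarrow> w \<in> W \<Longrightarrow> v + w \<in> W" "\<And>c v. v \<in> W \<Longrightarrow> c \<cdot>\<^sub>v v \<in> W"
    and "\<And>g w. g \<in> carrier G \<Longrightarrow> w \<in> W \<Longrightarrow> \<rho> g *\<^sub>v w \<in> W"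
  using assms
  unfolding invariant_subspace_def VectorSpace.subspace_def LinearCombinations.submodule_def
  by (auto simp: module_vec_def)

lemma mat_trace_mult_comm:
  fixes A B :: "'a :: comm_semiring_0 mat"
  assumes "A \<in> carrier_mat m k" "B \<in> carrier_mat k m"
  shows "mat_trace (A * B) = mat_trace (B * A)"
proof -
  have "mat_trace (A * B) = (\<Sum>i<m. \<Sum>j<k. A $$ (i, j) * B $$ (j, i))"
    using assms by (auto simp: mat_trace_def scalar_prod_def lessThan_atLeast0 intro!: sum.cong)
  also have "\<dots> = (\<Sum>j<k. \<Sum>i<m. A $$ (i, j) * B $$ (j, i))" by (rule sum.swap)
  also have "\<dots> = mat_trace (B * A)"
    using assms by (auto simp: mat_trace_def scalar_prod_def lessThan_atLeast0 mult.commute intro!: sum.cong)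
  finally show ?thesis .
qed

lemma mat_mult_unit_vec:
  fixes A :: "'a :: semiring_1 mat"
  assumes "A \<in> carrier_mat m k" "j < k"
  shows "A *\<^sub>v unit_vec k j = col A j"
  using assms by (intro eq_vecI) auto

lemma mat_eq_0_if_mult_vec_0:
  fixes A :: "'a :: semiring_1 mat"
  assumes A: "A \<in> carrier_mat m k" and 0: "\<And>v. v \<in> carrier_vec k \<Longrightarrow> A *\<^sub>v v = 0\<^sub>v m"
  shows "A = 0\<^sub>m m k"
proof (rule eq_matI)
  fix i j assume "i < dim_row (0\<^sub>m m k :: 'a mat)" "j < dim_col (0\<^sub>m m k :: 'a mat)"
  then have ij: "i < m" "j < k" by auto
  have "col A j $ i = (0\<^sub>v m :: 'a vec) $ i"
    using 0[of "unit_vec k j"] mat_mult_unit_vec[OF A ij(2)] by simp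
  then show "A $$ (i, j) = 0\<^sub>m m k $$ (i, j)" using A ij by simp
qed (use A in auto)

lemma mat_eqI_mult_vec:
  fixes A B :: "'a :: semiring_1 mat"
  assumes "A \<in> carrier_mat m k" "B \<in> carrier_mat m k"
    and eq: "\<And>j. j < k \<Longrightarrow> A *\<^sub>v unit_vec k j = B *\<^sub>v unit_vec k j"
  shows "A = B"
proof (rule eq_matI)
  fix i j assume "i < dim_row B" "j < dim_col B"
  then have ij: "i < m" "j < k" using assms by auto
  have "col A j $ i = col B j $ i"
    using eq[OF ij(2)] mat_mult_unit_vec[OF assms(1) ij(2)] mat_mult_unit_vec[OF assms(2) ij(2)] by simp
  then show "A $$ (i, j) = B $$ (i, j)" using assms ij by simp
qed (use assms in auto)

text \<open>Rectangular because Schur's lemma applies it before the two dimensions are known to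
  agree. Surjectivity gives a right inverse column by column; injectivity makes it
  two-sided.\<close>

lemma bij_mat_inverse:
  fixes T :: "'a :: comm_ring_1 mat"
  assumes T: "T \<in> carrier_mat d e"
    and inj: "\<And>v. v \<in> carrier_vec e \<Longrightarrow> T *\<^sub>v v = 0\<^sub>v d \<Longrightarrow> v = 0\<^sub>v e"
    and surj: "\<And>w. w \<in> carrier_vec d \<Longrightarrow> \<exists>v \<in> carrier_vec e. T *\<^sub>v v = w"
  shows "\<exists>T' \<in> carrier_mat e d. T * T' = 1\<^sub>m d \<and> T' * T = 1\<^sub>m e"
proof -
  obtain p where p: "\<And>j. j < d \<Longrightarrow> p j \<in> carrier_vec e \<and> T *\<^sub>v p j = unit_vec d j"
  proof -
    have "\<forall>j. \<exists>v. j < d \<longrightarrow> v \<in> carrier_vec e \<and> T *\<^sub>v v = unit_vec d j"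
      using surj[OF unit_vec_carrier] by blast
    then show ?thesis using that by metis
  qed
  define T' where "T' = Matrix.mat e d (\<lambda>(i, j). p j $ i)"
  have T': "T' \<in> carrier_mat e d" by (simp add: T'_def)
  have col: "T' *\<^sub>v unit_vec d j = p j" if "j < d" for j
    using that p[OF that] mat_mult_unit_vec[OF T' that]
    by (auto intro!: eq_vecI simp: T'_def)
  have 1: "T * T' = 1\<^sub>m d"
  proof (rule mat_eqI_mult_vec)
    fix j assume j: "j < d"
    have "(T * T') *\<^sub>v unit_vec d j = T *\<^sub>v (T' *\<^sub>v unit_vec d j)"
      using T T' by (simp add: assoc_mult_mat_vec)
    then show "(T * T') *\<^sub>v unit_vec d j = 1\<^sub>m d *\<^sub>v unit_vec d j"
      using col[OF j] p[OF j] by simp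
  qed (use T T' in auto)
  have 2: "T' * T = 1\<^sub>m e"
  proof (rule mat_eqI_mult_vec)
    fix j assume j: "j < e"
    let ?u = "unit_vec e j :: 'a vec"
    let ?v = "T' *\<^sub>v (T *\<^sub>v ?u)"
    have u: "?u \<in> carrier_vec e" by simp
    have v: "?v \<in> carrier_vec e" using T T' by auto
    have "T *\<^sub>v ?v = (T * T') *\<^sub>v (T *\<^sub>v ?u)"
      using T T' by (simp add: assoc_mult_mat_vec[of _ d e _ d])
    then have "T *\<^sub>v ?v = T *\<^sub>v ?u" using 1 T by simp
    then have "T *\<^sub>v (?v - ?u) = 0\<^sub>v d"
      using T u v by (simp add: mult_minus_distrib_mat_vec[OF T v u])
    then have "?v - ?u = 0\<^sub>v e" using inj u v by simp
    then have "\<forall>i<e. (?v - ?u) $ i = 0" by simp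
    then have "\<forall>i<e. ?v $ i = ?u $ i" using u v by auto
    then have "?v = ?u" using u v T' by (intro eq_vecI) auto
    then show "(T' * T) *\<^sub>v ?u = 1\<^sub>m e *\<^sub>v ?u"
      using T T' u by (simp add: assoc_mult_mat_vec[of _ e d _ e])
  qed (use T T' in auto)
  from 1 2 T' show ?thesis by blast
qed

section \<open>Schur's lemma and orthogonality\<close>

lemma irreducible_representationD:
  assumes "group G" "irreducible_representation G d \<rho>"
  shows "mat_rep G d \<rho>" "0 < d"
    and "\<And>W. invariant_subspace G d \<rho> W \<Longrightarrow> W = {0\<^sub>v d} \<or> W = carrier_vec d"
  using assms group.hom_GL_iff_mat_rep[OF assms(1)]
  by (auto simp: irreducible_representation_def)

text \<open>The kernel \<open>W\<close> and the image \<open>U\<close> of \<open>T\<close> are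
  invariant subspaces; as \<open>T\<close> is nonzero, irreducibility makes the first trivial and
  the second everything.\<close>

lemma schur_invertible:
  assumes G: "group G" and \<rho>: "irreducible_representation G d \<rho>"
    and \<sigma>: "irreducible_representation G e \<sigma>"
    and T: "T \<in> carrier_mat d e" and TG: "\<And>g. g \<in> carrier G \<Longrightarrow> \<rho> g * T = T * \<sigma> g"
    and T0: "T \<noteq> 0\<^sub>m d e"
  shows "\<exists>T' \<in> carrier_mat e d. T * T' = 1\<^sub>m d \<and> T' * T = 1\<^sub>m e"
proof -
  note \<rho>' = irreducible_representationD[OF G \<rho>] and \<sigma>' = irreducible_representationD[OF G \<sigma>]
  have \<rho>c: "\<rho> g \<in> carrier_mat d d" and \<sigma>c: "\<sigma> g \<in> carrier_mat e e" if "g \<in> carrier G" for g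
    using \<rho>'(1) \<sigma>'(1) that by (auto simp: mat_rep_def)
  have eq: "T *\<^sub>v (\<sigma> g *\<^sub>v v) = \<rho> g *\<^sub>v (T *\<^sub>v v)" if "g \<in> carrier G" "v \<in> carrier_vec e" for g v
  proof -
    have "T *\<^sub>v (\<sigma> g *\<^sub>v v) = (T * \<sigma> g) *\<^sub>v v"
      using T \<sigma>c that by (simp add: assoc_mult_mat_vec[of _ d e _ e])
    also have "\<dots> = (\<rho> g * T) *\<^sub>v v" using TG that by simp
    also have "\<dots> = \<rho> g *\<^sub>v (T *\<^sub>v v)"
      using T \<rho>c that by (simp add: assoc_mult_mat_vec[of _ d d _ e])
    finally show ?thesis .
  qed
  define W where "W = {v \<in> carrier_vec e. T *\<^sub>v v = 0\<^sub>v d}"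
  have "invariant_subspace G e \<sigma> W"
  proof (rule invariant_subspaceI)
    show "v + w \<in> W" if "v \<in> W" "w \<in> W" for v w
      using that T by (auto simp: W_def mult_add_distrib_mat_vec[of _ d e])
    show "c \<cdot>\<^sub>v v \<in> W" if "v \<in> W" for c v
      using that T by (auto simp: W_def mult_mat_vec[of _ d e])
    show "\<sigma> g *\<^sub>v w \<in> W" if "g \<in> carrier G" "w \<in> W" for g w
    proof -
      have "\<rho> g *\<^sub>v 0\<^sub>v d = 0\<^sub>v d" using \<rho>c[OF that(1)] by (intro eq_vecI) auto
      then show ?thesis using that \<sigma>c[OF that(1)] eq by (auto simp: W_def)
    qed
  qed (use T in \<open>auto simp: W_def\<close>)
  moreover have "W \<noteq> carrier_vec e"
    using mat_eq_0_if_mult_vec_0[OF T] T0 by (auto simp: W_def)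
  ultimately have W: "W = {0\<^sub>v e}" using \<sigma>'(3) by blast
  define U where "U = (\<lambda>v. T *\<^sub>v v) ` carrier_vec e"
  have "invariant_subspace G d \<rho> U"
  proof (rule invariant_subspaceI)
    show "U \<subseteq> carrier_vec d" using T by (auto simp: U_def)
    have "T *\<^sub>v 0\<^sub>v e = 0\<^sub>v d" using T by (intro eq_vecI) auto
    then show "0\<^sub>v d \<in> U" by (auto simp: U_def intro!: image_eqI[of _ _ "0\<^sub>v e"])
    show "v + w \<in> U" if "v \<in> U" "w \<in> U" for v w
      using that T by (auto simp: U_def mult_add_distrib_mat_vec[of _ d e, symmetric])
    show "c \<cdot>\<^sub>v v \<in> U" if "v \<in> U" for c v
      using that T by (auto simp: U_def mult_mat_vec[of _ d e, symmetric])
    show "\<rho> g *\<^sub>v w \<in> U" if "g \<in> carrier G" "w \<in> U" for g w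
      using that eq[OF that(1), symmetric] \<sigma>c[OF that(1)] by (auto simp: U_def)
  qed
  moreover have "U \<noteq> {0\<^sub>v d}"
    using mat_eq_0_if_mult_vec_0[OF T] T0 by (auto simp: U_def)
  ultimately have U: "U = carrier_vec d" using \<rho>'(3) by blast
  show ?thesis
  proof (rule bij_mat_inverse[OF T])
    show "v = 0\<^sub>v e" if "v \<in> carrier_vec e" "T *\<^sub>v v = 0\<^sub>v d" for v
      using that W by (auto simp: W_def)
    show "\<exists>v \<in> carrier_vec e. T *\<^sub>v v = w" if "w \<in> carrier_vec d" for w
    proof -
      have "w \<in> U" using that U by simp
      then show ?thesis by (auto simp: U_def)
    qed
  qed
qed

text \<open>An eigenspace of \<open>T\<close> is invariant and nonzero, hence the whole space. The
  eigenvalue exists because the scalars are complex.\<close>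

lemma schur_scalar:
  assumes G: "group G" and \<rho>: "irreducible_representation G d \<rho>"
    and T: "T \<in> carrier_mat d d" and TG: "\<And>g. g \<in> carrier G \<Longrightarrow> \<rho> g * T = T * \<rho> g"
  shows "\<exists>c. T = c \<cdot>\<^sub>m 1\<^sub>m d"
proof -
  note \<rho>' = irreducible_representationD[OF G \<rho>]
  have \<rho>c: "\<rho> g \<in> carrier_mat d d" if "g \<in> carrier G" for g
    using \<rho>'(1) that by (auto simp: mat_rep_def)
  obtain c where "c \<in> spectrum T" using spectrum_non_empty[OF T] \<rho>'(2) by auto
  then obtain u where u: "u \<in> carrier_vec d" "u \<noteq> 0\<^sub>v d" "T *\<^sub>v u = c \<cdot>\<^sub>v u"
    using T by (auto simp: spectrum_def eigenvalue_def eigenvector_def)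
  define W where "W = {v \<in> carrier_vec d. T *\<^sub>v v = c \<cdot>\<^sub>v v}"
  have "invariant_subspace G d \<rho> W"
  proof (rule invariant_subspaceI)
    have "T *\<^sub>v 0\<^sub>v d = 0\<^sub>v d" using T by (intro eq_vecI) auto
    then show "0\<^sub>v d \<in> W" by (auto simp: W_def)
    show "v + w \<in> W" if "v \<in> W" "w \<in> W" for v w
      using that T by (auto simp: W_def mult_add_distrib_mat_vec[of _ d d] smult_add_distrib_vec)
    show "a \<cdot>\<^sub>v v \<in> W" if "v \<in> W" for a v
      using that T by (auto simp: W_def mult_mat_vec[of _ d d] smult_smult_assoc mult.commute)
    show "\<rho> g *\<^sub>v w \<in> W" if "g \<in> carrier G" "w \<in> W" for g w
    proof -
      have w: "w \<in> carrier_vec d" "T *\<^sub>v w = c \<cdot>\<^sub>v w" using that by (auto simp: W_def)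
      have "T *\<^sub>v (\<rho> g *\<^sub>v w) = (T * \<rho> g) *\<^sub>v w"
        using T \<rho>c[OF that(1)] w by (simp add: assoc_mult_mat_vec[of _ d d _ d])
      also have "\<dots> = \<rho> g *\<^sub>v (T *\<^sub>v w)"
        using T \<rho>c[OF that(1)] w TG[OF that(1), symmetric] by (simp add: assoc_mult_mat_vec[of _ d d _ d])
      also have "\<dots> = c \<cdot>\<^sub>v (\<rho> g *\<^sub>v w)"
        using w \<rho>c[OF that(1)] by (simp add: mult_mat_vec[of _ d d])
      finally show ?thesis using w \<rho>c[OF that(1)] by (auto simp: W_def)
    qed
  qed (auto simp: W_def)
  moreover have "W \<noteq> {0\<^sub>v d}" using u by (auto simp: W_def)
  ultimately have W: "W = carrier_vec d" using \<rho>'(3) by blast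
  have "T = c \<cdot>\<^sub>m 1\<^sub>m d"
  proof (rule mat_eqI_mult_vec[OF T])
    fix j assume j: "j < d"
    have "unit_vec d j \<in> W" using W by simp
    moreover have "(c \<cdot>\<^sub>m 1\<^sub>m d) *\<^sub>v unit_vec d j = c \<cdot>\<^sub>v unit_vec d j"
      using j by (intro eq_vecI) (auto simp: row_def scalar_prod_def if_distrib cong: if_cong)
    ultimately show "T *\<^sub>v unit_vec d j = (c \<cdot>\<^sub>m 1\<^sub>m d) *\<^sub>v unit_vec d j"
      by (simp add: W_def)
  qed simp
  then show ?thesis ..
qed

section \<open>Orthogonality of irreducible characters\<close>

context group
begin

lemma mult_index:
  fixes \<rho> :: "'a \<Rightarrow> complex mat"
  assumes "mat_rep G d \<rho>" "g \<in> carrier G" "h \<in> carrier G" "i < d" "j < d"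
  shows "\<rho> (g \<otimes> h) $$ (i, j) = (\<Sum>m<d. \<rho> g $$ (i, m) * \<rho> h $$ (m, j))"
proof -
  have "\<rho> (g \<otimes> h) = \<rho> g * \<rho> h" "\<rho> g \<in> carrier_mat d d" "\<rho> h \<in> carrier_mat d d"
    using assms by (auto simp: mat_rep_def)
  then show ?thesis using assms by (auto simp: scalar_prod_def lessThan_atLeast0)
qed

lemma sum_translate:
  assumes "h \<in> carrier G"
  shows "(\<Sum>g\<in>carrier G. f (h \<otimes> g)) = (\<Sum>g\<in>carrier G. f g)"
proof (rule sum.reindex_bij_betw)
  show "bij_betw (\<lambda>g. h \<otimes> g) (carrier G) (carrier G)"
    by (rule bij_betw_byWitness[of _ "\<lambda>g. inv h \<otimes> g"])
      (use assms in \<open>auto simp: m_assoc[symmetric]\<close>)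
qed

text \<open>The sum over \<open>g\<close> of \<open>\<rho> g * E * \<sigma> (inv g)\<close>, written
  entrywise, where \<open>E\<close> is the matrix unit with its 1 in position
  \<open>(j, k)\<close>.\<close>

definition average_intertwiner ::
    "nat \<Rightarrow> nat \<Rightarrow> ('a \<Rightarrow> complex mat) \<Rightarrow> ('a \<Rightarrow> complex mat) \<Rightarrow> nat \<Rightarrow> nat \<Rightarrow> complex mat" where
  "average_intertwiner d e \<rho> \<sigma> j k =
     Matrix.mat d e (\<lambda>(i, l). \<Sum>g\<in>carrier G. \<rho> g $$ (i, j) * \<sigma> (inv g) $$ (k, l))"

lemma average_intertwiner_carrier [simp]:
  "average_intertwiner d e \<rho> \<sigma> j k \<in> carrier_mat d e"
  by (simp add: average_intertwiner_def)

lemma average_intertwiner_commutes: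
  assumes \<rho>: "mat_rep G d \<rho>" and \<sigma>: "mat_rep G e \<sigma>" and jk: "j < d" "k < e" and h: "h \<in> carrier G"
  shows "\<rho> h * average_intertwiner d e \<rho> \<sigma> j k = average_intertwiner d e \<rho> \<sigma> j k * \<sigma> h"
proof (rule eq_matI)
  let ?S = "average_intertwiner d e \<rho> \<sigma> j k"
  have c: "\<rho> h \<in> carrier_mat d d" "\<sigma> h \<in> carrier_mat e e"
    using \<rho> \<sigma> h by (auto simp: mat_rep_def)
  fix i l assume "i < dim_row (?S * \<sigma> h)" "l < dim_col (?S * \<sigma> h)"
  then have il: "i < d" "l < e" using c by (auto simp: average_intertwiner_def)
  have "(\<rho> h * ?S) $$ (i, l) =
      (\<Sum>m<d. \<rho> h $$ (i, m) * (\<Sum>g\<in>carrier G. \<rho> g $$ (m, j) * \<sigma> (inv g) $$ (k, l)))"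
    using c il by (auto simp: average_intertwiner_def scalar_prod_def lessThan_atLeast0 intro!: sum.cong)
  also have "\<dots> = (\<Sum>g\<in>carrier G. (\<Sum>m<d. \<rho> h $$ (i, m) * \<rho> g $$ (m, j)) * \<sigma> (inv g) $$ (k, l))"
    by (simp add: sum_distrib_left sum_distrib_right mult.assoc) (rule sum.swap)
  \<comment> \<open>Since \<open>inv g = inv (h \<otimes> g) \<otimes> h\<close>, the summand
    depends on \<open>g\<close> only through \<open>h \<otimes> g\<close>, and the sum can be
    translated.\<close>
  also have "\<dots> = (\<Sum>g\<in>carrier G. \<rho> (h \<otimes> g) $$ (i, j) * \<sigma> (inv (h \<otimes> g) \<otimes> h) $$ (k, l))"
    using h il jk by (auto simp: mult_index[OF \<rho>] inv_mult_group m_assoc intro!: sum.cong)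
  also have "\<dots> = (\<Sum>g\<in>carrier G. \<rho> g $$ (i, j) * \<sigma> (inv g \<otimes> h) $$ (k, l))"
    by (rule sum_translate[OF h, of "\<lambda>g. \<rho> g $$ (i, j) * \<sigma> (inv g \<otimes> h) $$ (k, l)"])
  also have "\<dots> = (\<Sum>g\<in>carrier G. \<rho> g $$ (i, j) * (\<Sum>m<e. \<sigma> (inv g) $$ (k, m) * \<sigma> h $$ (m, l)))"
    using h il jk by (auto simp: mult_index[OF \<sigma>] intro!: sum.cong)
  also have "\<dots> = (\<Sum>m<e. (\<Sum>g\<in>carrier G. \<rho> g $$ (i, j) * \<sigma> (inv g) $$ (k, m)) * \<sigma> h $$ (m, l))"
    by (simp add: sum_distrib_left sum_distrib_right mult.assoc) (rule sum.swap)
  also have "\<dots> = (?S * \<sigma> h) $$ (i, l)"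
    using c il by (auto simp: average_intertwiner_def scalar_prod_def lessThan_atLeast0 intro!: sum.cong)
  finally show "(\<rho> h * ?S) $$ (i, l) = (?S * \<sigma> h) $$ (i, l)" .
qed (use \<rho> \<sigma> h in \<open>auto simp: mat_rep_def average_intertwiner_def\<close>)

text \<open>Not divided by the group order, so norm 1 reads \<open>card (carrier G)\<close>.
  Evaluating at \<open>inv g\<close> replaces complex conjugation, which keeps the form bilinear and
  avoids unitary representations.\<close>

definition class_inner :: "('a \<Rightarrow> complex) \<Rightarrow> ('a \<Rightarrow> complex) \<Rightarrow> complex" where
  "class_inner f h = (\<Sum>g\<in>carrier G. f g * h (inv g))"

text \<open>Entry \<open>(i, k)\<close> of the average of the matrix unit \<open>(i, k)\<close> is
  the sum of \<open>\<rho> g $$ (i, i) * \<sigma> (inv g) $$ (k, k)\<close>, one term of the product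
  of traces. Schur's lemma can now evaluate the inner product.\<close>

lemma class_inner_trace:
  assumes \<rho>: "mat_rep G d \<rho>" and \<sigma>: "mat_rep G e \<sigma>"
  shows "class_inner (\<lambda>g. mat_trace (\<rho> g)) (\<lambda>g. mat_trace (\<sigma> g)) =
         (\<Sum>i<d. \<Sum>k<e. average_intertwiner d e \<rho> \<sigma> i k $$ (i, k))"
proof -
  have "mat_trace (\<rho> g) * mat_trace (\<sigma> (inv g)) =
      (\<Sum>i<d. \<Sum>k<e. \<rho> g $$ (i, i) * \<sigma> (inv g) $$ (k, k))" if "g \<in> carrier G" for g
  proof -
    have "dim_row (\<rho> g) = d" "dim_row (\<sigma> (inv g)) = e"
      using \<rho> \<sigma> that by (auto simp: mat_rep_def)
    then show ?thesis by (simp add: mat_trace_def sum_product)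
  qed
  then have "class_inner (\<lambda>g. mat_trace (\<rho> g)) (\<lambda>g. mat_trace (\<sigma> g)) =
      (\<Sum>g\<in>carrier G. \<Sum>i<d. \<Sum>k<e. \<rho> g $$ (i, i) * \<sigma> (inv g) $$ (k, k))"
    by (simp add: class_inner_def)
  also have "\<dots> = (\<Sum>i<d. \<Sum>g\<in>carrier G. \<Sum>k<e. \<rho> g $$ (i, i) * \<sigma> (inv g) $$ (k, k))"
    by (rule sum.swap)
  also have "\<dots> = (\<Sum>i<d. \<Sum>k<e. \<Sum>g\<in>carrier G. \<rho> g $$ (i, i) * \<sigma> (inv g) $$ (k, k))"
    by (intro sum.cong refl sum.swap)
  finally show ?thesis by (simp add: average_intertwiner_def)
qed

text \<open>A nonzero average would be an invertible intertwiner, and conjugate matrices have equal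
  traces. Hence distinct characters suffice as hypothesis, and isomorphism of representations never
  has to be defined.\<close>

lemma class_inner_irreducible_diff:
  assumes \<rho>: "irreducible_representation G d \<rho>" and \<sigma>: "irreducible_representation G e \<sigma>"
    and diff: "\<exists>g\<in>carrier G. mat_trace (\<rho> g) \<noteq> mat_trace (\<sigma> g)"
  shows "class_inner (\<lambda>g. mat_trace (\<rho> g)) (\<lambda>g. mat_trace (\<sigma> g)) = 0"
proof -
  note \<rho>' = irreducible_representationD[OF is_group \<rho>]
    and \<sigma>' = irreducible_representationD[OF is_group \<sigma>]
  have "average_intertwiner d e \<rho> \<sigma> i k = 0\<^sub>m d e" if ik: "i < d" "k < e" for i k
  proof (rule ccontr)
    let ?T = "average_intertwiner d e \<rho> \<sigma> i k"
    note com = average_intertwiner_commutes[OF \<rho>'(1) \<sigma>'(1) ik]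
    assume "?T \<noteq> 0\<^sub>m d e"
    then obtain T' where T': "T' \<in> carrier_mat e d" "?T * T' = 1\<^sub>m d" "T' * ?T = 1\<^sub>m e"
      using schur_invertible[OF is_group \<rho> \<sigma> average_intertwiner_carrier com] by blast
    have "mat_trace (\<rho> g) = mat_trace (\<sigma> g)" if g: "g \<in> carrier G" for g
    proof -
      have c: "\<rho> g \<in> carrier_mat d d" "\<sigma> g \<in> carrier_mat e e"
        using \<rho>'(1) \<sigma>'(1) g by (auto simp: mat_rep_def)
      have T: "?T \<in> carrier_mat d e" by simp
      have "\<rho> g = (\<rho> g * ?T) * T'"
        using T'(1,2) c T by (simp add: assoc_mult_mat[of _ d d _ e _ d])
      also have "\<dots> = ?T * (\<sigma> g * T')"
        using T'(1) c T com[OF g] by (simp add: assoc_mult_mat[of _ d e _ e _ d])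
      finally have "mat_trace (\<rho> g) = mat_trace ((\<sigma> g * T') * ?T)"
        using T'(1) c T mat_trace_mult_comm[of ?T d e "\<sigma> g * T'"] by simp
      also have "(\<sigma> g * T') * ?T = \<sigma> g"
        using T'(1,3) c T by (simp add: assoc_mult_mat[of _ e e _ d _ e])
      finally show ?thesis .
    qed
    with diff show False by blast
  qed
  then show ?thesis by (simp add: class_inner_trace[OF \<rho>'(1) \<sigma>'(1)])
qed

lemma class_inner_irreducible_same:
  assumes \<rho>: "irreducible_representation G d \<rho>"
  shows "class_inner (\<lambda>g. mat_trace (\<rho> g)) (\<lambda>g. mat_trace (\<rho> g)) = of_nat (card (carrier G))"
proof -
  note \<rho>' = irreducible_representationD[OF is_group \<rho>]
  let ?S = "average_intertwiner d d \<rho> \<rho>"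
  have "\<exists>c. \<forall>i<d. \<forall>k<d. ?S i k = c i k \<cdot>\<^sub>m 1\<^sub>m d"
  proof -
    have "\<forall>i k. \<exists>c. i < d \<longrightarrow> k < d \<longrightarrow> ?S i k = c \<cdot>\<^sub>m 1\<^sub>m d"
      using schur_scalar[OF is_group \<rho> average_intertwiner_carrier]
        average_intertwiner_commutes[OF \<rho>'(1) \<rho>'(1)] by blast
    then show ?thesis by metis
  qed
  then obtain c where c: "\<And>i k. i < d \<Longrightarrow> k < d \<Longrightarrow> ?S i k = c i k \<cdot>\<^sub>m 1\<^sub>m d" by blast
  \<comment> \<open>The trace of this scalar matrix computed a second way: summing over
    \<open>l\<close> closes up to \<open>\<rho> (inv g \<otimes> g)\<close>, the identity
    matrix.\<close>
  have tr: "of_nat d * c i i = of_nat (card (carrier G))" if i: "i < d" for i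
  proof -
    have "of_nat d * c i i = mat_trace (?S i i)"
      using c[OF i i] by (simp add: mat_trace_def)
    also have "\<dots> = (\<Sum>l<d. \<Sum>g\<in>carrier G. \<rho> g $$ (l, i) * \<rho> (inv g) $$ (i, l))"
      by (simp add: mat_trace_def average_intertwiner_def)
    also have "\<dots> = (\<Sum>g\<in>carrier G. \<Sum>l<d. \<rho> (inv g) $$ (i, l) * \<rho> g $$ (l, i))"
      by (subst sum.swap) (simp add: mult.commute)
    also have "\<dots> = (\<Sum>g\<in>carrier G. \<rho> (inv g \<otimes> g) $$ (i, i))"
      using i by (intro sum.cong refl) (simp only: mult_index[OF \<rho>'(1)] inv_closed)
    also have "\<dots> = of_nat (card (carrier G))"
      using i \<rho>'(1) by (simp add: mat_rep_def)
    finally show ?thesis .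
  qed
  have "(\<Sum>i<d. \<Sum>k<d. ?S i k $$ (i, k)) = (\<Sum>i<d. \<Sum>k<d. if i = k then c i i else 0)"
    by (intro sum.cong refl) (auto simp: c)
  also have "\<dots> = (\<Sum>i<d. c i i)" by simp
  also have "of_nat d * \<dots> = of_nat d * (of_nat (card (carrier G)) :: complex)"
    by (simp add: sum_distrib_left tr)
  finally show ?thesis using \<rho>'(2) by (simp add: class_inner_trace[OF \<rho>'(1) \<rho>'(1)])
qed

lemma class_inner_irreducible_character:
  assumes "irreducible_character G \<chi>" "irreducible_character G \<psi>"
  shows "class_inner \<chi> \<psi> = (if \<chi> = \<psi> then of_nat (card (carrier G)) else 0)"
proof -
  obtain d \<rho> e \<sigma> where \<rho>: "irreducible_representation G d \<rho>" "\<chi> = (\<lambda>g\<in>carrier G. mat_trace (\<rho> g))"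
    and \<sigma>: "irreducible_representation G e \<sigma>" "\<psi> = (\<lambda>g\<in>carrier G. mat_trace (\<sigma> g))"
    using assms by (auto simp: irreducible_character_def)
  have eq: "class_inner \<chi> \<psi> = class_inner (\<lambda>g. mat_trace (\<rho> g)) (\<lambda>g. mat_trace (\<sigma> g))"
    "class_inner \<chi> \<chi> = class_inner (\<lambda>g. mat_trace (\<rho> g)) (\<lambda>g. mat_trace (\<rho> g))"
    by (auto simp: class_inner_def \<rho>(2) \<sigma>(2) intro!: sum.cong)
  show ?thesis
  proof (cases "\<chi> = \<psi>")
    case True
    then show ?thesis using eq(2) class_inner_irreducible_same[OF \<rho>(1)] by simp
  next
    case False
    then have "\<exists>g\<in>carrier G. mat_trace (\<rho> g) \<noteq> mat_trace (\<sigma> g)"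
      by (auto simp: \<rho>(2) \<sigma>(2) fun_eq_iff restrict_def split: if_splits)
    then show ?thesis using False eq(1) class_inner_irreducible_diff[OF \<rho>(1) \<sigma>(1)] by simp
  qed
qed

end

section \<open>Virtual characters\<close>

text \<open>
  The columns of \<open>P\<close> are a basis of the whole space; those indexed by \<open>K\<close> span \<open>W\<close>.
  The basis is found by maximising \<open>card K\<close>.
\<close>
lemma adapted_basis:
  fixes W :: "'a :: field vec set"
  assumes W: "W \<subseteq> carrier_vec d" "0\<^sub>v d \<in> W"
    and add: "\<And>v w. v \<in> W \<Longrightarrow> w \<in> W \<Longrightarrow> v + w \<in> W" and smult: "\<And>c v. v \<in> W \<Longrightarrow> c \<cdot>\<^sub>v v \<in> W"
  obtains P Q K where "P \<in> carrier_mat d d" "Q \<in> carrier_mat d d" "P * Q = 1\<^sub>m d" "Q * P = 1\<^sub>m d"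
    "K \<subseteq> {..<d}" "\<And>i. i \<in> K \<Longrightarrow> P *\<^sub>v unit_vec d i \<in> W"
    "\<And>v i. v \<in> W \<Longrightarrow> i < d \<Longrightarrow> i \<notin> K \<Longrightarrow> (Q *\<^sub>v v) $ i = 0"
proof -
  define good where "good = (\<lambda>(P, Q, K). P \<in> carrier_mat d d \<and> Q \<in> carrier_mat d d \<and> P * Q = 1\<^sub>m d \<and>
     Q * P = 1\<^sub>m d \<and> K \<subseteq> {..<d} \<and> (\<forall>i\<in>K. P *\<^sub>v unit_vec d i \<in> W))"
  have "good (1\<^sub>m d, 1\<^sub>m d, {})" by (simp add: good_def)
  moreover have "card K < Suc d" if "good (P, Q, K)" for P Q K
    using that card_mono[of "{..<d}" K] by (auto simp: good_def)
  ultimately obtain x where x: "good x" and max: "\<And>y. good y \<Longrightarrow> card (snd (snd y)) \<le> card (snd (snd x))"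
    using ex_has_greatest_nat[of good _ "\<lambda>x. card (snd (snd x))" "Suc d"]
    by (metis (no_types, opaque_lifting) prod.collapse)
  obtain P Q K where PQK: "x = (P, Q, K)" by (cases x) auto
  have g: "P \<in> carrier_mat d d" "Q \<in> carrier_mat d d" "P * Q = 1\<^sub>m d" "Q * P = 1\<^sub>m d"
    "K \<subseteq> {..<d}" "\<And>i. i \<in> K \<Longrightarrow> P *\<^sub>v unit_vec d i \<in> W"
    using x by (auto simp: good_def PQK)
  have "(Q *\<^sub>v w) $ i = 0" if w: "w \<in> W" and i: "i < d" "i \<notin> K" for w i
  proof (rule ccontr)
    define y where "y = Q *\<^sub>v w"
    assume "(Q *\<^sub>v w) $ i \<noteq> 0"
    then have yi: "y $ i \<noteq> 0" by (simp add: y_def)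
    have wc: "w \<in> carrier_vec d" using w W by auto
    have yc: "y \<in> carrier_vec d" using g wc by (auto simp: y_def)
    \<comment> \<open>\<open>F\<close> is the identity with column \<open>i\<close> replaced by
      \<open>y\<close>, so \<open>P * F\<close> exchanges the basis vector number \<open>i\<close>
      for \<open>w\<close>. Its inverse \<open>F'\<close> exists because \<open>y $ i\<close> is
      nonzero.\<close>
    define F where "F = Matrix.mat d d (\<lambda>(a, b). if b = i then y $ a else if a = b then 1 else 0)"
    define F' where "F' = Matrix.mat d d (\<lambda>(a, b). if b = i then (if a = i then 1 / y $ i else - (y $ a / y $ i))
        else if a = b then 1 else 0)"
    have Fc: "F \<in> carrier_mat d d" "F' \<in> carrier_mat d d" by (auto simp: F_def F'_def)
    have FF: "F * F' = 1\<^sub>m d" "F' * F = 1\<^sub>m d"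
    proof -
      have "(\<Sum>m<d. F $$ (a, m) * F' $$ (m, b)) = (if a = b then 1 else 0)"
        "(\<Sum>m<d. F' $$ (a, m) * F $$ (m, b)) = (if a = b then 1 else 0)" if ab: "a < d" "b < d" for a b
      proof -
        have F: "F $$ (a, m) = (if m = i then y $ a else 0) + (if m = a then (if a = i then 0 else 1) else 0)"
          if "m < d" for m using that ab by (auto simp: F_def)
        have F': "F' $$ (a, m) = (if m = i then (if a = i then 1 / y $ i else - (y $ a / y $ i)) else 0) +
            (if m = a then (if a = i then 0 else 1) else 0)"
          if "m < d" for m using that ab by (auto simp: F'_def)
        show "(\<Sum>m<d. F $$ (a, m) * F' $$ (m, b)) = (if a = b then 1 else 0)"
          using ab i yi by (simp add: F algebra_simps sum.distrib if_distrib[of "\<lambda>x. _ * x"] cong: if_cong)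
            (auto simp: F'_def)
        show "(\<Sum>m<d. F' $$ (a, m) * F $$ (m, b)) = (if a = b then 1 else 0)"
          using ab i yi by (simp add: F' algebra_simps sum.distrib if_distrib[of "\<lambda>x. _ * x"] cong: if_cong)
            (auto simp: F_def)
      qed
      then show "F * F' = 1\<^sub>m d" "F' * F = 1\<^sub>m d"
        using Fc by (auto intro!: eq_matI simp: scalar_prod_def lessThan_atLeast0)
    qed
    have "good (P * F, F' * Q, insert i K)"
    proof -
      have 1: "(P * F) * (F' * Q) = 1\<^sub>m d"
      proof -
        have "(P * F) * (F' * Q) = P * ((F * F') * Q)"
          using g(1,2) Fc by (simp add: assoc_mult_mat[of _ d d _ d _ d])
        then show ?thesis using g FF by simp
      qed
      have 2: "(F' * Q) * (P * F) = 1\<^sub>m d"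
      proof -
        have "(F' * Q) * (P * F) = F' * ((Q * P) * F)"
          using g(1,2) Fc by (simp add: assoc_mult_mat[of _ d d _ d _ d])
        then show ?thesis using g Fc FF by simp
      qed
      have 3: "(P * F) *\<^sub>v unit_vec d j \<in> W" if j: "j \<in> insert i K" for j
      proof -
        have jd: "j < d" using j i g(5) by auto
        have col: "(P * F) *\<^sub>v unit_vec d j = P *\<^sub>v col F j"
          using g Fc jd by (simp add: assoc_mult_mat_vec[of _ d d _ d] mat_mult_unit_vec[OF Fc(1) jd])
        show ?thesis
        proof (cases "j = i")
          case True
          have "col F i = y" using yc i by (intro eq_vecI) (auto simp: F_def)
          moreover have "P *\<^sub>v y = w"
          proof -
            have "P *\<^sub>v y = (P * Q) *\<^sub>v w" unfolding y_def
              using g(1,2) wc by (simp add: assoc_mult_mat_vec[of _ d d _ d])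
            then show ?thesis using g wc by simp
          qed
          ultimately show ?thesis using col w True by simp
        next
          case False
          then have "col F j = unit_vec d j" using jd by (intro eq_vecI) (auto simp: F_def)
          then show ?thesis using col g(6)[of j] j False by simp
        qed
      qed
      show ?thesis using 1 2 3 g Fc i by (auto simp: good_def)
    qed
    from max[OF this] have "card (insert i K) \<le> card K" by (simp add: PQK)
    moreover have "finite K" using g(5) finite_subset by blast
    ultimately show False using i by simp
  qed
  with g that show ?thesis by blast
qed

context group
begin

lemma mat_rep_conjugate:
  assumes \<rho>: "mat_rep G d \<rho>" and P: "P \<in> carrier_mat d d" "Q \<in> carrier_mat d d" "P * Q = 1\<^sub>m d" "Q * P = 1\<^sub>m d"
  shows "mat_rep G d (\<lambda>g. Q * (\<rho> g * P))"
    and "g \<in> carrier G \<Longrightarrow> mat_trace (Q * (\<rho> g * P)) = mat_trace (\<rho> g)"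
proof -
  have c: "\<rho> g \<in> carrier_mat d d" if "g \<in> carrier G" for g using \<rho> that by (auto simp: mat_rep_def)
  have "Q * (\<rho> (g \<otimes> h) * P) = (Q * (\<rho> g * P)) * (Q * (\<rho> h * P))" if gh: "g \<in> carrier G" "h \<in> carrier G" for g h
  proof -
    have "(Q * (\<rho> g * P)) * (Q * (\<rho> h * P)) = Q * (\<rho> g * ((P * Q) * (\<rho> h * P)))"
      using P(1,2) c[OF gh(1)] c[OF gh(2)] by (simp add: assoc_mult_mat[of _ d d _ d _ d])
    also have "(P * Q) * (\<rho> h * P) = \<rho> h * P" using P c[OF gh(2)] by simp
    also have "Q * (\<rho> g * (\<rho> h * P)) = Q * ((\<rho> g * \<rho> h) * P)"
      using P c[OF gh(1)] c[OF gh(2)] by (simp add: assoc_mult_mat[of _ d d _ d _ d])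
    finally show ?thesis using \<rho> gh by (simp add: mat_rep_def)
  qed
  then show "mat_rep G d (\<lambda>g. Q * (\<rho> g * P))"
    using \<rho> P by (auto simp: mat_rep_def)
  assume g: "g \<in> carrier G"
  have "mat_trace (Q * (\<rho> g * P)) = mat_trace ((\<rho> g * P) * Q)"
    using P c[OF g] by (intro mat_trace_mult_comm[of _ d d]) auto
  also have "(\<rho> g * P) * Q = \<rho> g"
    using P c[OF g] by (simp add: assoc_mult_mat[of _ d d _ d _ d])
  finally show "mat_trace (Q * (\<rho> g * P)) = mat_trace (\<rho> g)" .
qed

text \<open>The hypothesis asks only that the product of the two entries vanish, so it covers both
  diagonal blocks of a block triangular form: for the subspace the second factor is 0, for the
  quotient the first.\<close>

lemma mat_rep_block:
  assumes \<rho>: "mat_rep G d \<rho>" and L: "L \<subseteq> {..<d}"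
    and block: "\<And>g h i j m. g \<in> carrier G \<Longrightarrow> h \<in> carrier G \<Longrightarrow> i \<in> L \<Longrightarrow> j \<in> L \<Longrightarrow> m < d \<Longrightarrow> m \<notin> L \<Longrightarrow>
      \<rho> g $$ (i, m) * \<rho> h $$ (m, j) = 0"
  shows "\<exists>\<tau>. mat_rep G (card L) \<tau> \<and> (\<forall>g\<in>carrier G. mat_trace (\<tau> g) = (\<Sum>i\<in>L. \<rho> g $$ (i, i)))"
proof -
  have fin: "finite L" using L finite_subset by blast
  obtain e where e: "bij_betw e {..<card L} L"
    using ex_bij_betw_nat_finite[OF fin] by (auto simp: lessThan_atLeast0)
  define \<tau> where "\<tau> g = Matrix.mat (card L) (card L) (\<lambda>(a, b). \<rho> g $$ (e a, e b))" for g
  have eL: "e a \<in> L" "e a < d" if "a < card L" for a using e that L by (auto simp: bij_betw_def)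
  have "\<tau> (g \<otimes> h) = \<tau> g * \<tau> h" if gh: "g \<in> carrier G" "h \<in> carrier G" for g h
  proof (rule eq_matI)
    fix a b assume "a < dim_row (\<tau> g * \<tau> h)" "b < dim_col (\<tau> g * \<tau> h)"
    then have ab: "a < card L" "b < card L" by (auto simp: \<tau>_def)
    have "\<tau> (g \<otimes> h) $$ (a, b) = (\<Sum>m<d. \<rho> g $$ (e a, m) * \<rho> h $$ (m, e b))"
      using ab gh eL by (simp add: \<tau>_def mult_index[OF \<rho>])
    also have "\<dots> = (\<Sum>m\<in>L. \<rho> g $$ (e a, m) * \<rho> h $$ (m, e b))"
      using L block[OF gh eL(1)[OF ab(1)] eL(1)[OF ab(2)]] by (intro sum.mono_neutral_right) auto
    also have "\<dots> = (\<Sum>c<card L. \<rho> g $$ (e a, e c) * \<rho> h $$ (e c, e b))"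
      by (rule sum.reindex_bij_betw[OF e, symmetric])
    also have "\<dots> = (\<tau> g * \<tau> h) $$ (a, b)"
      using ab by (simp add: \<tau>_def scalar_prod_def lessThan_atLeast0)
    finally show "\<tau> (g \<otimes> h) $$ (a, b) = (\<tau> g * \<tau> h) $$ (a, b)" .
  qed (auto simp: \<tau>_def)
  moreover have "\<tau> \<one> = 1\<^sub>m (card L)"
    using \<rho> eL e by (intro eq_matI) (auto simp: \<tau>_def mat_rep_def bij_betw_def inj_on_def)
  ultimately have "mat_rep G (card L) \<tau>" by (auto simp: mat_rep_def \<tau>_def)
  moreover have "mat_trace (\<tau> g) = (\<Sum>i\<in>L. \<rho> g $$ (i, i))" for g
    using sum.reindex_bij_betw[OF e, of "\<lambda>i. \<rho> g $$ (i, i)"] by (simp add: mat_trace_def \<tau>_def)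
  ultimately show ?thesis by blast
qed

text \<open>\<open>S\<close> is a set of functions rather than a family of representations, so its
  members are pairwise distinct and therefore orthogonal.\<close>

definition virtual_character :: "('a \<Rightarrow> complex) \<Rightarrow> bool" where
  "virtual_character \<theta> \<longleftrightarrow> (\<exists>S z. finite S \<and> (\<forall>\<chi>\<in>S. irreducible_character G \<chi>) \<and>
     (\<forall>g\<in>carrier G. \<theta> g = (\<Sum>\<chi>\<in>S. of_int (z \<chi>) * \<chi> g)))"

lemma virtual_character_add:
  assumes "virtual_character f" "virtual_character h"
  shows "virtual_character (\<lambda>g. f g + h g)"
proof -
  obtain S z where S: "finite S" "\<forall>\<chi>\<in>S. irreducible_character G \<chi>"
    "\<forall>g\<in>carrier G. f g = (\<Sum>\<chi>\<in>S. of_int (z \<chi>) * \<chi> g)"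
    using assms(1) by (auto simp: virtual_character_def)
  obtain T y where T: "finite T" "\<forall>\<chi>\<in>T. irreducible_character G \<chi>"
    "\<forall>g\<in>carrier G. h g = (\<Sum>\<chi>\<in>T. of_int (y \<chi>) * \<chi> g)"
    using assms(2) by (auto simp: virtual_character_def)
  define x where "x \<chi> = (if \<chi> \<in> S then z \<chi> else 0) + (if \<chi> \<in> T then y \<chi> else 0)" for \<chi>
  have "f g + h g = (\<Sum>\<chi>\<in>S \<union> T. of_int (x \<chi>) * \<chi> g)" if "g \<in> carrier G" for g
  proof -
    have "(\<Sum>\<chi>\<in>S. of_int (z \<chi>) * \<chi> g) = (\<Sum>\<chi>\<in>S \<union> T. of_int (if \<chi> \<in> S then z \<chi> else 0) * \<chi> g)"
      using S(1) T(1) by (intro sum.mono_neutral_cong_left) auto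
    moreover have "(\<Sum>\<chi>\<in>T. of_int (y \<chi>) * \<chi> g) = (\<Sum>\<chi>\<in>S \<union> T. of_int (if \<chi> \<in> T then y \<chi> else 0) * \<chi> g)"
      using S(1) T(1) by (intro sum.mono_neutral_cong_left) auto
    ultimately show ?thesis
      using S(3) T(3) that by (simp add: x_def sum.distrib distrib_right)
  qed
  then show ?thesis using S(1,2) T(1,2) by (auto simp: virtual_character_def intro!: exI[of _ "S \<union> T"] exI[of _ x])
qed

lemma virtual_character_cong:
  "(\<And>g. g \<in> carrier G \<Longrightarrow> f g = h g) \<Longrightarrow> virtual_character f \<longleftrightarrow> virtual_character h"
  by (simp add: virtual_character_def)

text \<open>
  Complete reducibility is not needed here: the trace only sees the diagonal blocks of a
  block triangular form.
\<close>
lemma virtual_character_trace: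
  assumes "mat_rep G d \<rho>"
  shows "virtual_character (\<lambda>g. mat_trace (\<rho> g))"
  using assms
proof (induction d arbitrary: \<rho> rule: less_induct)
  case (less d)
  have c: "\<rho> g \<in> carrier_mat d d" if "g \<in> carrier G" for g using less.prems that by (auto simp: mat_rep_def)
  consider "d = 0" | "irreducible_representation G d \<rho>" |
    W where "invariant_subspace G d \<rho> W" "W \<noteq> {0\<^sub>v d}" "W \<noteq> carrier_vec d"
    using less.prems hom_GL_iff_mat_rep by (auto simp: irreducible_representation_def)
  then show ?case
  proof cases
    case 1
    then have "mat_trace (\<rho> g) = 0" if "g \<in> carrier G" for g using c[OF that] by (auto simp: mat_trace_def)
    then show ?thesis by (auto simp: virtual_character_def intro!: exI[of _ "{}"])
  next
    case 2
    then have "irreducible_character G (\<lambda>g\<in>carrier G. mat_trace (\<rho> g))"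
      by (auto simp: irreducible_character_def)
    then show ?thesis
      unfolding virtual_character_def
      by (intro exI[of _ "{\<lambda>g\<in>carrier G. mat_trace (\<rho> g)}"] exI[of _ "\<lambda>_. 1"]) auto
  next
    case (3 W)
    note W = invariant_subspaceD[OF 3(1)]
    obtain P Q K where PQ: "P \<in> carrier_mat d d" "Q \<in> carrier_mat d d" "P * Q = 1\<^sub>m d" "Q * P = 1\<^sub>m d"
      and K: "K \<subseteq> {..<d}" "\<And>i. i \<in> K \<Longrightarrow> P *\<^sub>v unit_vec d i \<in> W"
        "\<And>v i. v \<in> W \<Longrightarrow> i < d \<Longrightarrow> i \<notin> K \<Longrightarrow> (Q *\<^sub>v v) $ i = 0"
      using adapted_basis[OF W(1-4)] by blast
    define \<sigma> where "\<sigma> = (\<lambda>g. Q * (\<rho> g * P))"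
    have \<sigma>: "mat_rep G d \<sigma>" and tr: "\<And>g. g \<in> carrier G \<Longrightarrow> mat_trace (\<sigma> g) = mat_trace (\<rho> g)"
      using mat_rep_conjugate[OF less.prems PQ] by (auto simp: \<sigma>_def)
    have zero: "\<sigma> g $$ (i, j) = 0" if g: "g \<in> carrier G" and ij: "i < d" "i \<notin> K" "j \<in> K" for g i j
    proof -
      have j: "j < d" using ij K(1) by auto
      have \<sigma>c: "\<sigma> g \<in> carrier_mat d d" using \<sigma> g by (auto simp: mat_rep_def)
      have "\<sigma> g $$ (i, j) = (\<sigma> g *\<^sub>v unit_vec d j) $ i"
        using mat_mult_unit_vec[OF \<sigma>c j] \<sigma>c ij j by simp
      also have "\<sigma> g *\<^sub>v unit_vec d j = Q *\<^sub>v (\<rho> g *\<^sub>v (P *\<^sub>v unit_vec d j))"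
        using PQ c[OF g] by (simp add: \<sigma>_def assoc_mult_mat_vec[of _ d d _ d])
      also have "\<dots> $ i = 0" using K(2)[OF ij(3)] W(5)[OF g] K(3) ij by blast
      finally show ?thesis .
    qed
    have finK: "finite K" using K(1) finite_subset by blast
    \<comment> \<open>If \<open>K\<close> contained all indices, \<open>W\<close> would be the whole
      space: any \<open>v\<close> is rebuilt inside \<open>W\<close> from its coordinates
      \<open>y\<close>, one column of \<open>P\<close> at a time.\<close>
    have "card K < d"
    proof (rule ccontr)
      assume "\<not> card K < d"
      then have Kd: "K = {..<d}" using K(1) card_seteq[of "{..<d}" K] by auto
      have "v \<in> W" if v: "v \<in> carrier_vec d" for v
      proof -
        define y where "y = Q *\<^sub>v v"
        have y: "y \<in> carrier_vec d" using PQ v by (auto simp: y_def)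
        have "P *\<^sub>v vec d (\<lambda>i. if i < m then y $ i else 0) \<in> W" if "m \<le> d" for m
          using that
        proof (induction m)
          case 0
          have "P *\<^sub>v vec d (\<lambda>i. 0) = 0\<^sub>v d" using PQ by (intro eq_vecI) (auto simp: scalar_prod_def)
          then show ?case using W(2) by simp
        next
          case (Suc m)
          have "vec d (\<lambda>i. if i < Suc m then y $ i else 0) =
              vec d (\<lambda>i. if i < m then y $ i else 0) + y $ m \<cdot>\<^sub>v unit_vec d m"
            by (intro eq_vecI) (auto simp: less_Suc_eq unit_vec_def)
          then have "P *\<^sub>v vec d (\<lambda>i. if i < Suc m then y $ i else 0) =
              P *\<^sub>v vec d (\<lambda>i. if i < m then y $ i else 0) + y $ m \<cdot>\<^sub>v (P *\<^sub>v unit_vec d m)"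
            using PQ by (simp add: mult_add_distrib_mat_vec[of _ d d] mult_mat_vec[of _ d d])
          moreover have "m \<in> K" using Suc.prems Kd by simp
          ultimately show ?case using Suc W(3,4) K(2) by simp
        qed
        from this[of d] have "P *\<^sub>v vec d (\<lambda>i. if i < d then y $ i else 0) \<in> W" by simp
        moreover have "vec d (\<lambda>i. if i < d then y $ i else 0) = y" using y by (intro eq_vecI) auto
        moreover have "P *\<^sub>v y = (P * Q) *\<^sub>v v" unfolding y_def
          using PQ(1,2) v by (simp add: assoc_mult_mat_vec[of _ d d _ d])
        ultimately show ?thesis using PQ v by simp
      qed
      with W(1) 3(3) show False by blast
    qed
    \<comment> \<open>If \<open>K\<close> were empty, \<open>Q\<close> would annihilate
      \<open>W\<close>, so \<open>W\<close> would be zero.\<close>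
    moreover have "K \<noteq> {}"
    proof
      assume K0: "K = {}"
      have "w = 0\<^sub>v d" if w: "w \<in> W" for w
      proof -
        have wc: "w \<in> carrier_vec d" using w W(1) by auto
        have "Q *\<^sub>v w = 0\<^sub>v d" using K(3)[OF w] K0 PQ by (intro eq_vecI) auto
        moreover have "P *\<^sub>v (Q *\<^sub>v w) = (P * Q) *\<^sub>v w"
          using PQ(1,2) wc by (simp add: assoc_mult_mat_vec[of _ d d _ d])
        moreover have "P *\<^sub>v 0\<^sub>v d = 0\<^sub>v d" using PQ by (intro eq_vecI) auto
        ultimately show ?thesis using PQ wc by simp
      qed
      with W(2) 3(2) show False by blast
    qed
    moreover have "card ({..<d} - K) = d - card K" using K(1) finK by (simp add: card_Diff_subset)
    ultimately have small: "card K < d" "card ({..<d} - K) < d"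
      using finK by (auto simp: card_gt_0_iff)
    have "\<exists>\<tau>. mat_rep G (card K) \<tau> \<and> (\<forall>g\<in>carrier G. mat_trace (\<tau> g) = (\<Sum>i\<in>K. \<sigma> g $$ (i, i)))"
      by (rule mat_rep_block[OF \<sigma> K(1)]) (simp add: zero)
    then obtain \<tau>1 where \<tau>1: "mat_rep G (card K) \<tau>1"
      "\<And>g. g \<in> carrier G \<Longrightarrow> mat_trace (\<tau>1 g) = (\<Sum>i\<in>K. \<sigma> g $$ (i, i))"
      by blast
    have "\<exists>\<tau>. mat_rep G (card ({..<d} - K)) \<tau> \<and>
        (\<forall>g\<in>carrier G. mat_trace (\<tau> g) = (\<Sum>i\<in>{..<d} - K. \<sigma> g $$ (i, i)))"
      by (rule mat_rep_block[OF \<sigma>]) (auto simp: zero)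
    then obtain \<tau>2 where \<tau>2: "mat_rep G (card ({..<d} - K)) \<tau>2"
      "\<And>g. g \<in> carrier G \<Longrightarrow> mat_trace (\<tau>2 g) = (\<Sum>i\<in>{..<d} - K. \<sigma> g $$ (i, i))"
      by blast
    have "mat_trace (\<tau>1 g) + mat_trace (\<tau>2 g) = mat_trace (\<rho> g)" if g: "g \<in> carrier G" for g
    proof -
      have "mat_trace (\<tau>1 g) + mat_trace (\<tau>2 g) = (\<Sum>i<d. \<sigma> g $$ (i, i))"
        using sum.subset_diff[OF K(1), of "\<lambda>i. \<sigma> g $$ (i, i)"] g by (simp add: \<tau>1(2) \<tau>2(2) add.commute)
      also have "\<dots> = mat_trace (\<sigma> g)" using \<sigma> g by (auto simp: mat_rep_def mat_trace_def)
      finally show ?thesis using tr g by simp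
    qed
    from virtual_character_cong[OF this]
    show ?thesis
      using virtual_character_add[OF less.IH[OF small(1) \<tau>1(1)] less.IH[OF small(2) \<tau>2(1)]] by simp
  qed
qed

text \<open>By orthogonality the norm is the sum of the squares of the integer coefficients, so
  exactly one of them is nonzero. Its sign stays open, hence the conclusion speaks of zeros
  only.\<close>

lemma virtual_character_norm_1:
  assumes fin: "finite (carrier G)" and \<theta>: "virtual_character \<theta>"
    and norm: "class_inner \<theta> \<theta> = of_nat (card (carrier G))"
  obtains \<chi> where "irreducible_character G \<chi>" "\<And>g. g \<in> carrier G \<Longrightarrow> \<theta> g = 0 \<Longrightarrow> \<chi> g = 0"
proof -
  obtain S z where S: "finite S" "\<And>\<chi>. \<chi> \<in> S \<Longrightarrow> irreducible_character G \<chi>"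
    and eq: "\<And>g. g \<in> carrier G \<Longrightarrow> \<theta> g = (\<Sum>\<chi>\<in>S. of_int (z \<chi>) * \<chi> g)"
    using \<theta> by (auto simp: virtual_character_def)
  have c0: "card (carrier G) \<noteq> 0" using fin one_closed by auto
  have "class_inner \<theta> \<theta> = (\<Sum>g\<in>carrier G. \<Sum>\<chi>\<in>S. \<Sum>\<psi>\<in>S. of_int (z \<chi> * z \<psi>) * (\<chi> g * \<psi> (inv g)))"
    by (simp add: class_inner_def eq sum_product mult_ac)
  also have "\<dots> = (\<Sum>\<chi>\<in>S. \<Sum>g\<in>carrier G. \<Sum>\<psi>\<in>S. of_int (z \<chi> * z \<psi>) * (\<chi> g * \<psi> (inv g)))"
    by (rule sum.swap)
  also have "\<dots> = (\<Sum>\<chi>\<in>S. \<Sum>\<psi>\<in>S. \<Sum>g\<in>carrier G. of_int (z \<chi> * z \<psi>) * (\<chi> g * \<psi> (inv g)))"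
    by (intro sum.cong refl sum.swap)
  also have "\<dots> = (\<Sum>\<chi>\<in>S. \<Sum>\<psi>\<in>S. of_int (z \<chi> * z \<psi>) * class_inner \<chi> \<psi>)"
    by (simp add: class_inner_def sum_distrib_left)
  also have "\<dots> = (\<Sum>\<chi>\<in>S. \<Sum>\<psi>\<in>S. if \<chi> = \<psi> then of_int (z \<chi> * z \<chi>) * of_nat (card (carrier G)) else 0)"
    by (intro sum.cong refl) (auto simp: class_inner_irreducible_character S(2))
  also have "\<dots> = of_int (\<Sum>\<chi>\<in>S. z \<chi> * z \<chi>) * of_nat (card (carrier G))"
    using S(1) by (simp add: sum_distrib_right)
  finally have "of_int (\<Sum>\<chi>\<in>S. z \<chi> * z \<chi>) = (1 :: complex)" using norm c0 by simp
  then have sum1: "(\<Sum>\<chi>\<in>S. z \<chi> * z \<chi>) = 1" using of_int_eq_1_iff by blast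
  then have "\<not> (\<forall>\<chi>\<in>S. z \<chi> = 0)" by (metis (no_types, lifting) mult_zero_left sum.neutral zero_neq_one)
  then obtain \<chi> where \<chi>: "\<chi> \<in> S" "z \<chi> \<noteq> 0" by blast
  have "z \<chi> * z \<chi> + (\<Sum>\<psi>\<in>S - {\<chi>}. z \<psi> * z \<psi>) = 1"
    using sum1 S(1) \<chi>(1) by (simp add: sum.remove)
  moreover have "z \<chi> * z \<chi> > 0" using \<chi>(2) by (auto simp: zero_less_mult_iff)
  moreover have "(\<Sum>\<psi>\<in>S - {\<chi>}. z \<psi> * z \<psi>) \<ge> 0" by (intro sum_nonneg) auto
  ultimately have "(\<Sum>\<psi>\<in>S - {\<chi>}. z \<psi> * z \<psi>) = 0" by linarith
  then have 0: "z \<psi> = 0" if "\<psi> \<in> S - {\<chi>}" for \<psi>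
    using sum_nonneg_eq_0_iff[of "S - {\<chi>}" "\<lambda>\<psi>. z \<psi> * z \<psi>"] S(1) that by auto
  have "\<theta> g = of_int (z \<chi>) * \<chi> g" if "g \<in> carrier G" for g
    using S(1) \<chi>(1) by (simp add: eq[OF that] sum.remove[of S \<chi>] 0)
  then show ?thesis using that[OF S(2)[OF \<chi>(1)]] \<chi>(2) by simp
qed

end

section \<open>Permutation characters\<close>

definition is_action :: "('a, 'b) monoid_scheme \<Rightarrow> 'x set \<Rightarrow> ('a \<Rightarrow> 'x \<Rightarrow> 'x) \<Rightarrow> bool" where
  "is_action G X a \<longleftrightarrow> (\<forall>g\<in>carrier G. \<forall>x\<in>X. a g x \<in> X) \<and> (\<forall>x\<in>X. a \<one>\<^bsub>G\<^esub> x = x) \<and>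
     (\<forall>g\<in>carrier G. \<forall>h\<in>carrier G. \<forall>x\<in>X. a (g \<otimes>\<^bsub>G\<^esub> h) x = a g (a h x))"

definition fix_char :: "'x set \<Rightarrow> ('a \<Rightarrow> 'x \<Rightarrow> 'x) \<Rightarrow> 'a \<Rightarrow> complex" where
  "fix_char X a g = of_nat (card {x \<in> X. a g x = x})"

context group
begin

lemma is_action_inv:
  assumes "is_action G X a" "g \<in> carrier G" "x \<in> X"
  shows "a (inv g) (a g x) = x" "a g (a (inv g) x) = x"
  using assms unfolding is_action_def by (metis inv_closed l_inv r_inv)+

text \<open>\<open>group_action\<close> takes values in \<open>Bij X\<close>, whose members are
  extensional, so the maps have to be cut off outside \<open>X\<close>.\<close>

lemma group_action_restrict:
  assumes a: "is_action G X a"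
  shows "group_action G X (\<lambda>g. \<lambda>x\<in>X. a g x)"
proof -
  have "(\<lambda>x\<in>X. a g x) \<in> Bij X" if g: "g \<in> carrier G" for g
  proof -
    have "bij_betw (\<lambda>x\<in>X. a g x) X X"
      by (rule bij_betw_byWitness[of _ "a (inv g)"])
        (use a g is_action_inv[OF a] in \<open>auto simp: is_action_def\<close>)
    then show ?thesis by (auto simp: Bij_def)
  qed
  moreover have "(\<lambda>x\<in>X. a (g \<otimes> h) x) = compose X (\<lambda>x\<in>X. a g x) (\<lambda>x\<in>X. a h x)"
    if "g \<in> carrier G" "h \<in> carrier G" for g h
    using a that by (auto simp: compose_def is_action_def restrict_def)
  ultimately have "(\<lambda>g. \<lambda>x\<in>X. a g x) \<in> hom G (BijGroup X)"
    by (auto simp: hom_def BijGroup_def)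
  then show ?thesis
    by (simp add: group_action_def group_hom_def group_hom_axioms_def is_group group_BijGroup)
qed

text \<open>The trace of a permutation matrix counts fixed points; a listing of \<open>X\<close>
  supplies the matrix indices.\<close>

lemma virtual_character_fix_char:
  assumes fin: "finite X" and a: "is_action G X a"
  shows "virtual_character (fix_char X a)"
proof -
  obtain xs where xs: "set xs = X" "distinct xs" using finite_distinct_list[OF fin] by blast
  define d where "d = length xs"
  define \<rho> :: "'a \<Rightarrow> complex mat" where
    "\<rho> g = Matrix.mat d d (\<lambda>(i, j). if a g (xs ! j) = xs ! i then 1 else 0)" for g
  have bij: "bij_betw (\<lambda>i. xs ! i) {..<d} X"
    using bij_betw_nth[OF xs(2)] xs(1) by (simp add: d_def)
  have X: "xs ! i \<in> X" if "i < d" for i using xs(1) that by (auto simp: d_def)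
  have inj: "xs ! i = xs ! j \<longleftrightarrow> i = j" if "i < d" "j < d" for i j
    using that xs(2) by (simp add: d_def nth_eq_iff_index_eq)
  have "\<rho> (g \<otimes> h) = \<rho> g * \<rho> h" if gh: "g \<in> carrier G" "h \<in> carrier G" for g h
  proof (rule eq_matI)
    fix i j assume "i < dim_row (\<rho> g * \<rho> h)" "j < dim_col (\<rho> g * \<rho> h)"
    then have ij: "i < d" "j < d" by (auto simp: \<rho>_def)
    have hj: "a h (xs ! j) \<in> X" using a gh X[OF ij(2)] by (auto simp: is_action_def)
    then obtain m where m: "m < d" "a h (xs ! j) = xs ! m"
      using xs(1) by (metis d_def in_set_conv_nth)
    have "(\<rho> g * \<rho> h) $$ (i, j) =
        (\<Sum>l<d. (if a g (xs ! l) = xs ! i then 1 else 0) * (if l = m then 1 else 0))"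
      using ij m by (auto simp: \<rho>_def scalar_prod_def lessThan_atLeast0 inj intro!: sum.cong)
    also have "\<dots> = (\<Sum>l<d. if l = m then (if a g (xs ! m) = xs ! i then 1 else 0) else 0)"
      by (intro sum.cong) auto
    also have "\<dots> = \<rho> (g \<otimes> h) $$ (i, j)"
      using ij m a gh X[OF ij(2)] by (simp add: \<rho>_def is_action_def)
    finally show "\<rho> (g \<otimes> h) $$ (i, j) = (\<rho> g * \<rho> h) $$ (i, j)" by simp
  qed (auto simp: \<rho>_def)
  moreover have "\<rho> \<one> = 1\<^sub>m d"
    using a X by (intro eq_matI) (auto simp: \<rho>_def inj is_action_def)
  ultimately have "mat_rep G d \<rho>" by (auto simp: mat_rep_def \<rho>_def)
  moreover have "mat_trace (\<rho> g) = fix_char X a g" if "g \<in> carrier G" for g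
  proof -
    have "mat_trace (\<rho> g) = (\<Sum>i<d. if a g (xs ! i) = xs ! i then 1 else 0)"
      by (simp add: mat_trace_def \<rho>_def)
    also have "\<dots> = (\<Sum>x\<in>X. if a g x = x then 1 else 0)"
      by (rule sum.reindex_bij_betw[OF bij])
    also have "\<dots> = fix_char X a g"
      using fin by (simp add: fix_char_def sum.If_cases Int_def)
    finally show ?thesis .
  qed
  ultimately show ?thesis using virtual_character_trace virtual_character_cong by metis
qed

text \<open>Removes the inverse in \<open>class_inner\<close>, after which a product of two such
  characters counts fixed points on pairs.\<close>

lemma fix_char_inv:
  assumes "is_action G X a" "g \<in> carrier G"
  shows "fix_char X a (inv g) = fix_char X a g"
proof -
  have "a (inv g) x = x \<longleftrightarrow> a g x = x" if "x \<in> X" for x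
    using is_action_inv[OF assms that] by metis
  then have "{x \<in> X. a (inv g) x = x} = {x \<in> X. a g x = x}" by blast
  then show ?thesis by (simp add: fix_char_def)
qed

text \<open>Burnside's lemma, with \<open>t\<close> a complete invariant for the orbits on pairs.\<close>
lemma class_inner_fix_char:
  assumes fin: "finite (carrier G)" "finite X" "finite Y"
    and a: "is_action G X a" and b: "is_action G Y b"
    and t: "\<And>x y x' y'. x \<in> X \<Longrightarrow> y \<in> Y \<Longrightarrow> x' \<in> X \<Longrightarrow> y' \<in> Y \<Longrightarrow>
      t x y = t x' y' \<longleftrightarrow> (\<exists>g\<in>carrier G. x' = a g x \<and> y' = b g y)"
  shows "class_inner (fix_char X a) (fix_char Y b) =
         of_nat (card ((\<lambda>(x, y). t x y) ` (X \<times> Y)) * card (carrier G))"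
proof -
  define c where "c g = (\<lambda>(x, y). (a g x, b g y))" for g
  have c: "is_action G (X \<times> Y) c" using a b by (auto simp: is_action_def c_def)
  define \<phi> where "\<phi> = (\<lambda>g. \<lambda>z\<in>X \<times> Y. c g z)"
  interpret A: group_action G "X \<times> Y" \<phi>
    using group_action_restrict[OF c] by (simp add: \<phi>_def)
  have inv: "invariants (X \<times> Y) \<phi> g = {x \<in> X. a g x = x} \<times> {y \<in> Y. b g y = y}" for g
    by (auto simp: invariants_def \<phi>_def c_def)
  have "class_inner (fix_char X a) (fix_char Y b) =
      (\<Sum>g\<in>carrier G. of_nat (card (invariants (X \<times> Y) \<phi> g)))"
    unfolding class_inner_def 
    by (intro sum.cong refl, subst fix_char_inv[OF b]) (simp_all add: inv fix_char_def card_cartesian_product)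
  also have "\<dots> = of_nat (\<Sum>g\<in>carrier G. card (invariants (X \<times> Y) \<phi> g))" by simp
  also have "\<dots> = of_nat (card (orbits G (X \<times> Y) \<phi>) * card (carrier G))"
    using A.burnside fin by (simp add: Coset.order_def del: of_nat_sum of_nat_mult)
  also have "card (orbits G (X \<times> Y) \<phi>) = card ((\<lambda>(x, y). t x y) ` (X \<times> Y))"
  proof -
    \<comment> \<open>The orbits are exactly the fibres of \<open>t\<close>, hence in bijection with
      its values.\<close>
    have orb: "orbit G \<phi> z = {w \<in> X \<times> Y. (\<lambda>(x, y). t x y) w = (\<lambda>(x, y). t x y) z}" if zXY: "z \<in> X \<times> Y" for z
    proof -
      obtain x y where z: "z = (x, y)" "x \<in> X" "y \<in> Y" using zXY by auto
      have "orbit G \<phi> z = {(a g x, b g y) |g. g \<in> carrier G}"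
        using z by (auto simp: orbit_def \<phi>_def c_def)
      also have "\<dots> = {w \<in> X \<times> Y. (\<lambda>(x, y). t x y) w = (\<lambda>(x, y). t x y) z}"
      proof (intro Set.set_eqI iffI)
        fix w assume "w \<in> {(a g x, b g y) |g. g \<in> carrier G}"
        then obtain g where g: "g \<in> carrier G" "w = (a g x, b g y)" by blast
        then have "a g x \<in> X" "b g y \<in> Y" using a b z by (auto simp: is_action_def)
        then have "t x y = t (a g x) (b g y)" using t[OF z(2,3)] g(1) by blast
        then show "w \<in> {w \<in> X \<times> Y. (\<lambda>(x, y). t x y) w = (\<lambda>(x, y). t x y) z}"
          using g z \<open>a g x \<in> X\<close> \<open>b g y \<in> Y\<close> by simp
      next
        fix w assume "w \<in> {w \<in> X \<times> Y. (\<lambda>(x, y). t x y) w = (\<lambda>(x, y). t x y) z}"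
        then obtain x' y' where w: "w = (x', y')" "x' \<in> X" "y' \<in> Y" "t x y = t x' y'" using z by auto
        then show "w \<in> {(a g x, b g y) |g. g \<in> carrier G}" using t[OF z(2,3) w(2,3)] by auto
      qed
      finally show ?thesis .
    qed
    let ?t = "\<lambda>(x, y). t x y"
    have "orbits G (X \<times> Y) \<phi> = orbit G \<phi> ` (X \<times> Y)" by (auto simp: orbits_def)
    also have "\<dots> = (\<lambda>z. {w \<in> X \<times> Y. ?t w = ?t z}) ` (X \<times> Y)" by (intro image_cong refl orb)
    also have "\<dots> = (\<lambda>v. {w \<in> X \<times> Y. ?t w = v}) ` ?t ` (X \<times> Y)" by (simp only: image_image)
    finally have "orbits G (X \<times> Y) \<phi> = (\<lambda>v. {w \<in> X \<times> Y. ?t w = v}) ` ?t ` (X \<times> Y)" .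
    moreover have "inj_on (\<lambda>v. {w \<in> X \<times> Y. ?t w = v}) (?t ` (X \<times> Y))"
      by (rule inj_onI) blast
    ultimately show ?thesis by (simp add: card_image)
  qed
  finally show ?thesis .
qed

end

section \<open>Colourings and contingency tables\<close>

text \<open>Colour 0 takes the remaining \<open>n - p - q\<close> points. When
  \<open>p + q \<le> n\<close>, the symmetric group acts on these colourings as on the cosets of a
  Young subgroup of type (n - p - q, p, q); this is the permutation character behind a product of
  three complete symmetric functions.\<close>

definition colourings :: "nat \<Rightarrow> nat \<Rightarrow> nat \<Rightarrow> (nat \<Rightarrow> nat) set" where
  "colourings n p q = {c \<in> {1..n} \<rightarrow>\<^sub>E {..<3}. card {x \<in> {1..n}. c x = 1} = p \<and> card {x \<in> {1..n}. c x = 2} = q}"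

text \<open>Composition with the inverse makes this a left action.\<close>

definition recolour :: "(nat \<Rightarrow> nat) \<Rightarrow> (nat \<Rightarrow> nat) \<Rightarrow> nat \<Rightarrow> nat" where
  "recolour g c = c \<circ> inv' g"

lemma finite_colourings: "finite (colourings n p q)"
  by (rule finite_subset[OF _ finite_PiE[of "{1..n}" "\<lambda>_. {..<3}"]]) (auto simp: colourings_def)

lemma colouringsD:
  assumes "c \<in> colourings n p q"
  shows "x \<in> {1..n} \<Longrightarrow> c x < 3" "x \<notin> {1..n} \<Longrightarrow> c x = undefined"
    "card {x \<in> {1..n}. c x = 1} = p" "card {x \<in> {1..n}. c x = 2} = q"
  using assms by (auto simp: colourings_def PiE_def extensional_def)

lemma card_permutes_image:
  assumes "g permutes A"
  shows "card {x \<in> A. P (g x)} = card {x \<in> A. P x}"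
proof -
  have "bij_betw g {x \<in> A. P (g x)} {x \<in> A. P x}"
    by (rule bij_betw_byWitness[of _ "inv' g"])
      (use assms in \<open>auto simp: permutes_inverses permutes_in_image[OF permutes_inv[OF assms]] permutes_in_image\<close>)
  then show ?thesis by (rule bij_betw_same_card)
qed

lemma is_action_recolour: "is_action (alt_group n) (colourings n p q) recolour"
proof -
  have "recolour g c \<in> colourings n p q" if g: "g permutes {1..n}" and c: "c \<in> colourings n p q" for g c
  proof -
    note ginv = permutes_inv[OF g]
    have "recolour g c \<in> {1..n} \<rightarrow>\<^sub>E {..<3}"
    proof (rule PiE_I)
      fix x show "x \<in> {1..n} \<Longrightarrow> recolour g c x \<in> {..<3}"
        using permutes_in_image[OF ginv] colouringsD(1)[OF c] by (simp add: recolour_def)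
      show "x \<notin> {1..n} \<Longrightarrow> recolour g c x = undefined"
        using permutes_not_in[OF ginv] colouringsD(2)[OF c] by (simp add: recolour_def)
    qed
    then show ?thesis
      using card_permutes_image[OF ginv, of "\<lambda>x. c x = 1"] card_permutes_image[OF ginv, of "\<lambda>x. c x = 2"] c
      by (simp add: colourings_def recolour_def)
  qed
  moreover have "recolour (g \<circ> h) c = recolour g (recolour h c)"
    if "g permutes {1..n}" "h permutes {1..n}" for g h and c
    using that by (simp add: recolour_def o_inv_distrib permutes_bij comp_assoc)
  ultimately show ?thesis
    by (auto simp: is_action_def alt_group_carrier alt_group_mult alt_group_one recolour_def)
qed

text \<open>Equal fibre sizes give a permutation carrying \<open>f\<close> to \<open>f'\<close>. If
  it is odd, precomposing with the swap of \<open>x\<close> and \<open>y\<close>, which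
  \<open>f\<close> does not notice, makes it even.\<close>

lemma permutes_matching_fibres:
  fixes f f' :: "'a \<Rightarrow> 'b"
  assumes fin: "finite A" and eq: "\<And>v. card {x \<in> A. f x = v} = card {x \<in> A. f' x = v}"
    and rep: "x \<in> A" "y \<in> A" "x \<noteq> y" "f x = f y"
  obtains p where "p permutes A" "evenperm p" "\<And>x. x \<in> A \<Longrightarrow> f x = f' (p x)"
proof -
  have "image_mset f (mset_set A) = image_mset f' (mset_set A)"
  proof (rule multiset_eqI)
    fix v
    have "count (image_mset h (mset_set A)) v = card {x \<in> A. h x = v}" for h :: "'a \<Rightarrow> 'b"
      using fin by (simp add: count_image_mset' eq_commute[of v])
    then show "count (image_mset f (mset_set A)) v = count (image_mset f' (mset_set A)) v"
      using eq by simp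
  qed
  then obtain p where p: "p permutes A" "\<forall>x\<in>A. f x = f' (p x)"
    using image_mset_eq_implies_permutes[OF fin] by blast
  show ?thesis
  proof (cases "evenperm p")
    case True
    with p that show ?thesis by blast
  next
    case False
    let ?p = "p \<circ> transpose x y"
    have "?p permutes A" using p(1) rep by (intro permutes_compose permutes_swap_id)
    moreover have "permutation p" using p(1) fin permutation_permutes by blast
    then have "evenperm ?p"
      using False rep(3) by (simp add: evenperm_comp evenperm_swap permutation_swap_id)
    moreover have "f z = f' (?p z)" if "z \<in> A" for z
      using p(2) rep that by (cases "z = x"; cases "z = y") (auto simp: transpose_def)
    ultimately show ?thesis using that by blast
  qed
qed

text \<open>\<open>A\<close> is matched with a disjoint union of blocks of sizes \<open>m v\<close>;
  the block label of a point is its value.\<close>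

lemma exists_prescribed_fibres:
  fixes m :: "'b \<Rightarrow> nat"
  assumes P: "finite P" and A: "finite A" "(\<Sum>v\<in>P. m v) = card A"
  obtains f where "f \<in> A \<rightarrow> P" "\<And>v. v \<in> P \<Longrightarrow> card {x \<in> A. f x = v} = m v"
proof -
  let ?S = "SIGMA v:P. {..<m v}"
  have "card ?S = card A" using P A by simp
  then obtain h where h: "bij_betw h A ?S"
    using finite_same_card_bij[of A ?S] P A by auto
  have "card {x \<in> A. fst (h x) = v} = m v" if v: "v \<in> P" for v
  proof -
    have "bij_betw h {x \<in> A. fst (h x) = v} ({v} \<times> {..<m v})"
      unfolding bij_betw_def
    proof
      show "inj_on h {x \<in> A. fst (h x) = v}" using h by (auto simp: bij_betw_def inj_on_def)
      have im: "h ` A = ?S" using h by (simp add: bij_betw_def)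
      show "h ` {x \<in> A. fst (h x) = v} = {v} \<times> {..<m v}"
      proof (intro Set.set_eqI iffI)
        fix z assume "z \<in> h ` {x \<in> A. fst (h x) = v}"
        then obtain x where "x \<in> A" "z = h x" "fst z = v" by auto
        moreover have "h x \<in> ?S" using im \<open>x \<in> A\<close> by blast
        ultimately show "z \<in> {v} \<times> {..<m v}" by (cases z) auto
      next
        fix z assume z: "z \<in> {v} \<times> {..<m v}"
        then have "z \<in> h ` A" using im v by auto
        then obtain x where "x \<in> A" "z = h x" by blast
        then show "z \<in> h ` {x \<in> A. fst (h x) = v}" using z by (intro image_eqI[of _ _ x]) auto
      qed
    qed
    then show ?thesis using bij_betw_same_card by fastforce
  qed
  moreover have "(\<lambda>x. fst (h x)) \<in> A \<rightarrow> P"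
  proof
    fix x assume "x \<in> A"
    then have "h x \<in> ?S" using h by (auto simp: bij_betw_def)
    then show "fst (h x) \<in> P" by (cases "h x") auto
  qed
  ultimately show ?thesis using that[of "\<lambda>x. fst (h x)"] by blast
qed

text \<open>The entry in row \<open>i\<close> and column \<open>j\<close> of the contingency table
  of two colourings.\<close>

definition overlap :: "nat \<Rightarrow> (nat \<Rightarrow> nat) \<Rightarrow> (nat \<Rightarrow> nat) \<Rightarrow> nat \<Rightarrow> nat \<Rightarrow> nat" where
  "overlap n c d i j = card {x \<in> {1..n}. c x = i \<and> d x = j}"

definition overlaps :: "nat \<Rightarrow> (nat \<Rightarrow> nat) \<Rightarrow> (nat \<Rightarrow> nat) \<Rightarrow> nat \<times> nat \<times> nat \<times> nat" where
  "overlaps n c d = (overlap n c d 1 1, overlap n c d 1 2, overlap n c d 2 1, overlap n c d 2 2)"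

lemma card_split3:
  fixes c :: "'a \<Rightarrow> nat"
  assumes "finite A" "\<And>x. x \<in> A \<Longrightarrow> c x < 3"
  shows "card {x \<in> A. P x} =
    card {x \<in> A. P x \<and> c x = 0} + card {x \<in> A. P x \<and> c x = 1} + card {x \<in> A. P x \<and> c x = 2}"
proof -
  have "{x \<in> A. P x} = ({x \<in> A. P x \<and> c x = 0} \<union> {x \<in> A. P x \<and> c x = 1}) \<union> {x \<in> A. P x \<and> c x = 2}"
    using assms(2) by (force simp: less_Suc_eq numeral_3_eq_3)
  moreover have "card \<dots> = card ({x \<in> A. P x \<and> c x = 0} \<union> {x \<in> A. P x \<and> c x = 1}) + card {x \<in> A. P x \<and> c x = 2}"
    using assms(1) by (intro card_Un_disjoint) auto
  moreover have "card ({x \<in> A. P x \<and> c x = 0} \<union> {x \<in> A. P x \<and> c x = 1}) =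
      card {x \<in> A. P x \<and> c x = 0} + card {x \<in> A. P x \<and> c x = 1}"
    using assms(1) by (intro card_Un_disjoint) auto
  ultimately show ?thesis by simp
qed

lemma card_colour_0:
  assumes "c \<in> colourings n p q"
  shows "card {x \<in> {1..n}. c x = 0} + p + q = n"
proof -
  have "{x \<in> {1..n}. True} = {1..n}" by auto
  then show ?thesis
    using card_split3[of "{1..n}" c "\<lambda>_. True"] colouringsD(1,3,4)[OF assms]
    by (simp only: simp_thms card_atLeastAtMost finite_atLeastAtMost diff_Suc_1)
qed

lemma overlap_sums:
  assumes c: "c \<in> colourings n p q" and d: "d \<in> colourings n p' q'"
  shows "overlap n c d 1 0 + overlap n c d 1 1 + overlap n c d 1 2 = p"
    and "overlap n c d 2 0 + overlap n c d 2 1 + overlap n c d 2 2 = q"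
    and "overlap n c d 0 1 + overlap n c d 1 1 + overlap n c d 2 1 = p'"
    and "overlap n c d 0 2 + overlap n c d 1 2 + overlap n c d 2 2 = q'"
    and "overlap n c d 0 0 + overlap n c d 0 1 + overlap n c d 0 2 + p + q = n"
proof -
  have row: "card {x \<in> {1..n}. c x = i} = overlap n c d i 0 + overlap n c d i 1 + overlap n c d i 2" for i
    using card_split3[of "{1..n}" d "\<lambda>x. c x = i"] colouringsD(1)[OF d] by (simp add: overlap_def)
  have col: "card {x \<in> {1..n}. d x = j} = overlap n c d 0 j + overlap n c d 1 j + overlap n c d 2 j" for j
    using card_split3[of "{1..n}" c "\<lambda>x. d x = j"] colouringsD(1)[OF c] by (simp add: overlap_def conj_commute)
  show "overlap n c d 1 0 + overlap n c d 1 1 + overlap n c d 1 2 = p"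
    "overlap n c d 2 0 + overlap n c d 2 1 + overlap n c d 2 2 = q"
    "overlap n c d 0 1 + overlap n c d 1 1 + overlap n c d 2 1 = p'"
    "overlap n c d 0 2 + overlap n c d 1 2 + overlap n c d 2 2 = q'"
    using row[of 1] row[of 2] col[of 1] col[of 2] colouringsD(3,4)[OF c] colouringsD(3,4)[OF d] by simp_all
  show "overlap n c d 0 0 + overlap n c d 0 1 + overlap n c d 0 2 + p + q = n"
    using row[of 0] card_colour_0[OF c] by simp
qed

text \<open>The margins recover row 0 and column 0 from the four recorded entries; beyond index 2
  every entry is 0.\<close>

lemma overlap_eqI:
  assumes cd: "c \<in> colourings n p q" "d \<in> colourings n p' q'" "c' \<in> colourings n p q" "d' \<in> colourings n p' q'"
    and eq: "overlaps n c d = overlaps n c' d'"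
  shows "overlap n c d i j = overlap n c' d' i j"
proof (cases "i < 3 \<and> j < 3")
  case True
  then have "i \<in> {0,1,2}" "j \<in> {0,1,2}" by auto
  then show ?thesis
    using eq overlap_sums[OF cd(1,2)] overlap_sums[OF cd(3,4)] by (auto simp: overlaps_def)
next
  case False
  have "overlap n x y i j = 0" if "x \<in> colourings n r s" "y \<in> colourings n r' s'" for x y r s r' s'
    using False colouringsD(1)[OF that(1)] colouringsD(1)[OF that(2)] by (auto simp: overlap_def)
  then show ?thesis using cd by simp
qed

text \<open>Two tables agree iff the maps to pairs of colours have equal fibre sizes. The two points
  in \<open>rep\<close> allow the matching permutation to be chosen even, so the table classifies
  orbits of the alternating group and not only of the symmetric group.\<close>

lemma overlaps_complete:
  assumes c: "c \<in> colourings n p q" and d: "d \<in> colourings n p' q'"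
    and c': "c' \<in> colourings n p q" and d': "d' \<in> colourings n p' q'"
    and rep: "\<exists>x\<in>{1..n}. \<exists>y\<in>{1..n}. x \<noteq> y \<and> c x = c y \<and> d x = d y"
  shows "overlaps n c d = overlaps n c' d' \<longleftrightarrow>
    (\<exists>g\<in>carrier (alt_group n). c' = recolour g c \<and> d' = recolour g d)"
proof
  assume eq: "overlaps n c d = overlaps n c' d'"
  obtain x y where xy: "x \<in> {1..n}" "y \<in> {1..n}" "x \<noteq> y" "(c x, d x) = (c y, d y)" using rep by auto
  have "card {x \<in> {1..n}. (c x, d x) = v} = card {x \<in> {1..n}. (c' x, d' x) = v}" for v
    using overlap_eqI[OF c d c' d' eq, of "fst v" "snd v"] by (cases v) (simp add: overlap_def)
  then obtain g where g: "g permutes {1..n}" "evenperm g"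
    "\<And>x. x \<in> {1..n} \<Longrightarrow> (c x, d x) = (c' (g x), d' (g x))"
    using permutes_matching_fibres[of "{1..n}" "\<lambda>x. (c x, d x)" "\<lambda>x. (c' x, d' x)", OF _ _ xy] by auto
  have "e' = recolour g e" if e: "e \<in> colourings n r s" "e' \<in> colourings n r s"
    and eg: "\<And>x. x \<in> {1..n} \<Longrightarrow> e x = e' (g x)" for e e' r s
  proof
    fix z
    show "e' z = recolour g e z"
    proof (cases "z \<in> {1..n}")
      case True
      then have "inv' g z \<in> {1..n}" using permutes_in_image[OF permutes_inv[OF g(1)]] by blast
      then show ?thesis using eg[of "inv' g z"] g(1) by (simp add: recolour_def permutes_inverses)
    next
      case False
      then show ?thesis
        using permutes_not_in[OF permutes_inv[OF g(1)] False] colouringsD(2)[OF e(1) False]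
          colouringsD(2)[OF e(2) False] by (simp add: recolour_def)
    qed
  qed
  from this[OF c c'] this[OF d d'] g
  show "\<exists>g\<in>carrier (alt_group n). c' = recolour g c \<and> d' = recolour g d"
    by (auto simp: alt_group_carrier)
next
  assume "\<exists>g\<in>carrier (alt_group n). c' = recolour g c \<and> d' = recolour g d"
  then obtain g where g: "g permutes {1..n}" "c' = recolour g c" "d' = recolour g d"
    by (auto simp: alt_group_carrier)
  have "overlap n c' d' i j = overlap n c d i j" for i j
    using card_permutes_image[OF permutes_inv[OF g(1)], of "\<lambda>x. c x = i \<and> d x = j"] g
    by (simp add: overlap_def recolour_def)
  then show "overlaps n c d = overlaps n c' d'" by (simp add: overlaps_def)
qed

text \<open>
  A table is determined by its margins and its entries with both indices in \<open>{1, 2}\<close>; the last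
  inequality says that the entry at \<open>(0, 0)\<close> is nonnegative.
\<close>
definition tables :: "nat \<Rightarrow> nat \<Rightarrow> nat \<Rightarrow> nat \<Rightarrow> nat \<Rightarrow> (nat \<times> nat \<times> nat \<times> nat) list" where
  "tables n p q p' q' = filter
     (\<lambda>(a, b, c, d). a + b \<le> p \<and> c + d \<le> q \<and> a + c \<le> p' \<and> b + d \<le> q' \<and> p + q + p' + q' \<le> n + a + b + c + d)
     (List.product [0..<Suc p] (List.product [0..<Suc p] (List.product [0..<Suc q] [0..<Suc q])))"

lemma mem_tables:
  "(a, b, c, d) \<in> set (tables n p q p' q') \<longleftrightarrow>
    a + b \<le> p \<and> c + d \<le> q \<and> a + c \<le> p' \<and> b + d \<le> q' \<and> p + q + p' + q' \<le> n + a + b + c + d"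
  by (auto simp: tables_def simp del: upt_Suc)

lemma overlaps_image:
  assumes "p + q \<le> n"
  shows "(\<lambda>(c, d). overlaps n c d) ` (colourings n p q \<times> colourings n p' q') = set (tables n p q p' q')"
proof (intro Set.set_eqI iffI)
  fix z assume "z \<in> (\<lambda>(c, d). overlaps n c d) ` (colourings n p q \<times> colourings n p' q')"
  then obtain c d where cd: "c \<in> colourings n p q" "d \<in> colourings n p' q'" "z = overlaps n c d" by auto
  show "z \<in> set (tables n p q p' q')"
  proof -
    define a where "a = overlap n c d 1 1"
    define b where "b = overlap n c d 1 2"
    define a' where "a' = overlap n c d 2 1"
    define b' where "b' = overlap n c d 2 2"
    note sums = overlap_sums[OF cd(1,2), folded a_def b_def a'_def b'_def]
    have "a + b \<le> p" "a' + b' \<le> q" "a + a' \<le> p'" "b + b' \<le> q'" "p + q + p' + q' \<le> n + a + b + a' + b'"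
      using sums by linarith+
    moreover have "z = (a, b, a', b')" by (simp add: cd(3) overlaps_def a_def b_def a'_def b'_def)
    ultimately show ?thesis by (simp add: mem_tables)
  qed
next
  fix z assume "z \<in> set (tables n p q p' q')"
  moreover obtain a b c d where z: "z = (a, b, c, d)" by (cases z) auto
  ultimately have le: "a + b \<le> p" "c + d \<le> q" "a + c \<le> p'" "b + d \<le> q'"
    "p + q + p' + q' \<le> n + a + b + c + d"
    by (simp_all add: mem_tables)
  \<comment> \<open>The unique completion of the four entries to a 3 x 3 table with the given
    margins; the inequalities in \<open>le\<close> make each subtraction exact.\<close>
  define m :: "nat \<times> nat \<Rightarrow> nat" where "m = (\<lambda>(i, j).
     if i = 0 then (if j = 0 then n + a + b + c + d - (p + q + p' + q') else if j = 1 then p' - (a + c) else q' - (b + d))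
     else if i = 1 then (if j = 0 then p - (a + b) else if j = 1 then a else b)
     else (if j = 0 then q - (c + d) else if j = 1 then c else d))"
  have three: "{..<3::nat} = {0, 1, 2}" by auto
  have "(\<Sum>v\<in>{..<3} \<times> {..<3}. m v) = (\<Sum>i<3. \<Sum>j<3. m (i, j))"
    by (simp add: sum.cartesian_product)
  also have "\<dots> = n" using le by (simp add: three m_def)
  finally have "(\<Sum>v\<in>{..<3} \<times> {..<3}. m v) = card {1..n}" by simp
  then obtain f where f: "f \<in> {1..n} \<rightarrow> {..<3} \<times> {..<3}"
    and fm: "\<And>v. v \<in> {..<3} \<times> {..<3} \<Longrightarrow> card {x \<in> {1..n}. f x = v} = m v"
    using exists_prescribed_fibres[of "{..<3} \<times> {..<3}" "{1..n}" m] by auto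
  define C where "C = (\<lambda>x\<in>{1..n}. fst (f x))"
  define D where "D = (\<lambda>x\<in>{1..n}. snd (f x))"
  have lt: "C x < 3" "D x < 3" if "x \<in> {1..n}" for x
    using f that by (auto simp: C_def D_def dest!: Pi_mem[of f _ _ x])
  have ov: "overlap n C D i j = m (i, j)" if "i < 3" "j < 3" for i j
  proof -
    have "{x \<in> {1..n}. C x = i \<and> D x = j} = {x \<in> {1..n}. f x = (i, j)}"
      by (auto simp: C_def D_def prod_eq_iff)
    then show ?thesis using fm[of "(i, j)"] that by (simp add: overlap_def)
  qed
  have row: "card {x \<in> {1..n}. C x = i} = m (i, 0) + m (i, 1) + m (i, 2)" if "i < 3" for i
    using card_split3[of "{1..n}" D "\<lambda>x. C x = i"] lt ov[OF that] by (simp add: overlap_def)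
  have col: "card {x \<in> {1..n}. D x = j} = m (0, j) + m (1, j) + m (2, j)" if "j < 3" for j
  proof -
    have "card {x \<in> {1..n}. D x = j \<and> C x = i} = m (i, j)" if "i < 3" for i
      using ov[OF that \<open>j < 3\<close>] by (simp only: overlap_def conj_commute[of "D _ = _"])
    then show ?thesis using card_split3[of "{1..n}" C "\<lambda>x. D x = j"] lt by simp
  qed
  have "C \<in> colourings n p q" "D \<in> colourings n p' q'"
    using row[of 1] row[of 2] col[of 1] col[of 2] lt le
    by (auto simp: colourings_def C_def D_def m_def)
  moreover have "overlaps n C D = z" by (simp add: overlaps_def ov z m_def)
  ultimately show "z \<in> (\<lambda>(c, d). overlaps n c d) ` (colourings n p q \<times> colourings n p' q')"
    by (auto intro!: image_eqI[of _ _ "(C, D)"])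
qed

abbreviation colouring_char :: "nat \<Rightarrow> nat \<Rightarrow> nat \<Rightarrow> (nat \<Rightarrow> nat) \<Rightarrow> complex" where
  "colouring_char n p q \<equiv> fix_char (colourings n p q) recolour"

lemma finite_alt_group: "finite (carrier (alt_group n))"
  by (rule finite_subset[OF _ finite_permutations[of "{1..n}"]]) (auto simp: alt_group_carrier)

lemma class_inner_colouring_char:
  assumes n: "p + q \<le> n"
    and rep: "\<And>c d. c \<in> colourings n p q \<Longrightarrow> d \<in> colourings n p' q' \<Longrightarrow>
      \<exists>x\<in>{1..n}. \<exists>y\<in>{1..n}. x \<noteq> y \<and> c x = c y \<and> d x = d y"
  shows "group.class_inner (alt_group n) (colouring_char n p q) (colouring_char n p' q') =
         of_nat (length (tables n p q p' q') * card (carrier (alt_group n)))"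
proof -
  interpret group "alt_group n" by (rule alt_group_is_group)
  have "distinct (tables n p q p' q')"
    unfolding tables_def by (intro distinct_filter distinct_product distinct_upt)
  then have "card ((\<lambda>(c, d). overlaps n c d) ` (colourings n p q \<times> colourings n p' q')) = length (tables n p q p' q')"
    by (simp add: overlaps_image[OF n] distinct_card)
  then show ?thesis
    using class_inner_fix_char[OF finite_alt_group finite_colourings finite_colourings
        is_action_recolour is_action_recolour overlaps_complete[OF _ _ _ _ rep]] by simp
qed

section \<open>Integer combinations of colouring characters\<close>

context group
begin

lemma virtual_character_of_int_mult:
  assumes "virtual_character f"
  shows "virtual_character (\<lambda>g. of_int s * f g)"
proof -
  obtain S z where S: "finite S" "\<forall>\<chi>\<in>S. irreducible_character G \<chi>"
    "\<forall>g\<in>carrier G. f g = (\<Sum>\<chi>\<in>S. of_int (z \<chi>) * \<chi> g)"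
    using assms(1) by (auto simp: virtual_character_def)
  then show ?thesis
    by (auto simp: virtual_character_def sum_distrib_left mult.assoc intro!: exI[of _ S] exI[of _ "\<lambda>\<chi>. s * z \<chi>"])
qed

lemma virtual_character_sum_list:
  assumes "\<And>x. x \<in> set xs \<Longrightarrow> virtual_character (f x)"
  shows "virtual_character (\<lambda>g. \<Sum>x\<leftarrow>xs. f x g)"
  using assms
proof (induction xs)
  case Nil
  then show ?case by (auto simp: virtual_character_def intro!: exI[of _ "{}"])
next
  case (Cons x xs)
  then show ?case using virtual_character_add[of "f x" "\<lambda>g. \<Sum>x\<leftarrow>xs. f x g"] by simp
qed

lemma class_inner_sum_list:
  "class_inner (\<lambda>g. \<Sum>x\<leftarrow>xs. f x g) (\<lambda>g. \<Sum>y\<leftarrow>ys. h y g) = (\<Sum>x\<leftarrow>xs. \<Sum>y\<leftarrow>ys. class_inner (f x) (h y))"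
proof -
  have left: "class_inner (\<lambda>g. \<Sum>x\<leftarrow>xs. f x g) k = (\<Sum>x\<leftarrow>xs. class_inner (f x) k)" for k
    by (induction xs) (simp_all add: class_inner_def distrib_right sum.distrib)
  have right: "class_inner k (\<lambda>g. \<Sum>y\<leftarrow>ys. h y g) = (\<Sum>y\<leftarrow>ys. class_inner k (h y))" for k
    by (induction ys) (simp_all add: class_inner_def distrib_left sum.distrib)
  show ?thesis by (simp add: left right)
qed

lemma class_inner_scale:
  "class_inner (\<lambda>g. a * f g) (\<lambda>g. b * h g) = a * b * class_inner f h"
  by (simp add: class_inner_def sum_distrib_left mult_ac)

end

text \<open>A triple \<open>(s, p, q)\<close> stands for one term of a Jacobi--Trudi determinant:
  the sign \<open>s\<close> times the product of the complete symmetric functions of degrees n - p -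
  q, p and q.\<close>

definition signed_char :: "nat \<Rightarrow> (int \<times> nat \<times> nat) list \<Rightarrow> (nat \<Rightarrow> nat) \<Rightarrow> complex" where
  "signed_char n xs g = (\<Sum>x\<leftarrow>xs. of_int (fst x) * colouring_char n (fst (snd x)) (snd (snd x)) g)"

text \<open>The norm of \<open>signed_char\<close> divided by the group order, once every pair of
  colourings has a repeated colour pair. It is a closed integer expression that can be
  evaluated.\<close>

definition signed_tables :: "nat \<Rightarrow> (int \<times> nat \<times> nat) list \<Rightarrow> int" where
  "signed_tables n xs = (\<Sum>x\<leftarrow>xs. \<Sum>y\<leftarrow>xs. fst x * fst y *
     int (length (tables n (fst (snd x)) (snd (snd x)) (fst (snd y)) (snd (snd y)))))"

lemma irreducible_character_signed_char:
  assumes le: "\<And>s p q. (s, p, q) \<in> set xs \<Longrightarrow> p + q \<le> n"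
    and rep: "\<And>s p q s' p' q' c d. (s, p, q) \<in> set xs \<Longrightarrow> (s', p', q') \<in> set xs \<Longrightarrow>
      c \<in> colourings n p q \<Longrightarrow> d \<in> colourings n p' q' \<Longrightarrow>
      \<exists>x\<in>{1..n}. \<exists>y\<in>{1..n}. x \<noteq> y \<and> c x = c y \<and> d x = d y"
    and norm: "signed_tables n xs = 1"
  obtains \<chi> where "irreducible_character (alt_group n) \<chi>"
    "\<And>g. g \<in> carrier (alt_group n) \<Longrightarrow> signed_char n xs g = 0 \<Longrightarrow> \<chi> g = 0"
proof -
  interpret group "alt_group n" by (rule alt_group_is_group)
  let ?h = "\<lambda>x g. of_int (fst x) * colouring_char n (fst (snd x)) (snd (snd x)) g"
  let ?t = "\<lambda>x y. length (tables n (fst (snd x)) (snd (snd x)) (fst (snd y)) (snd (snd y)))"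
  let ?N = "of_nat (card (carrier (alt_group n))) :: complex"
  have \<theta>: "signed_char n xs = (\<lambda>g. \<Sum>x\<leftarrow>xs. ?h x g)" by (simp add: signed_char_def fun_eq_iff)
  have "virtual_character (signed_char n xs)"
    unfolding \<theta> by (intro virtual_character_sum_list virtual_character_of_int_mult
        virtual_character_fix_char finite_colourings is_action_recolour)
  moreover have "class_inner (signed_char n xs) (signed_char n xs) = ?N"
  proof -
    have "class_inner (signed_char n xs) (signed_char n xs) = (\<Sum>x\<leftarrow>xs. \<Sum>y\<leftarrow>xs. class_inner (?h x) (?h y))"
      unfolding \<theta> by (rule class_inner_sum_list)
    also have "\<dots> = (\<Sum>x\<leftarrow>xs. \<Sum>y\<leftarrow>xs. of_int (fst x * fst y * int (?t x y)) * ?N)"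
    proof (intro arg_cong[where f = sum_list] map_cong refl)
      fix x y assume "x \<in> set xs" "y \<in> set xs"
      then have "(fst x, fst (snd x), snd (snd x)) \<in> set xs" "(fst y, fst (snd y), snd (snd y)) \<in> set xs"
        by simp_all
      from class_inner_colouring_char[OF le[OF this(1)] rep[OF this]]
      show "class_inner (?h x) (?h y) = of_int (fst x * fst y * int (?t x y)) * ?N"
        by (simp add: class_inner_scale)
    qed
    also have "\<dots> = of_int (signed_tables n xs) * ?N"
    proof -
      have "(\<Sum>x\<leftarrow>l. of_int (f x) * ?N) = of_int (\<Sum>x\<leftarrow>l. f x) * ?N" for l :: "(int \<times> nat \<times> nat) list" and f
        by (induction l) (simp_all add: distrib_right)
      then show ?thesis by (simp only: signed_tables_def)
    qed
    finally show ?thesis by (simp add: norm)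
  qed
  ultimately show ?thesis using virtual_character_norm_1[OF finite_alt_group] that by metis
qed

text \<open>At least three points have colour 0 under \<open>c\<close>, while \<open>d\<close> uses
  only the colours 0 and 1.\<close>

lemma repeated_colours_two:
  assumes c: "c \<in> colourings n p 0" and d: "d \<in> colourings n p' 0" and n: "p + 3 \<le> n"
  shows "\<exists>x\<in>{1..n}. \<exists>y\<in>{1..n}. x \<noteq> y \<and> c x = c y \<and> d x = d y"
proof (rule ccontr)
  let ?Z = "{x \<in> {1..n}. c x = 0}"
  assume *: "\<not> ?thesis"
  have "inj_on d ?Z" by (rule inj_onI) (use * in \<open>metis (mono_tags, lifting) mem_Collect_eq\<close>)
  moreover have "d ` ?Z \<subseteq> {0, 1}"
    using colouringsD(1,4)[OF d] by (force simp: less_Suc_eq numeral_3_eq_3)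
  ultimately have "card ?Z \<le> card {0, 1::nat}" by (intro card_inj_on_le) auto
  with card_colour_0[OF c] n show False by simp
qed

text \<open>There are nine colour pairs, so plain pigeonhole fails for n = 7, 8, 9. If no pair were
  repeated, each class of \<open>c\<close> would have at most 3 points; the bounds on
  \<open>p\<close> and \<open>q\<close> then force classes 0 and 1 to have exactly 3. Each would
  meet every colour of \<open>d\<close>, so colour 2 of \<open>d\<close> would occur twice, against
  \<open>q' \<le> 1\<close>.\<close>

lemma repeated_colours_three:
  assumes c: "c \<in> colourings n p q" and d: "d \<in> colourings n p' q'"
    and n: "7 \<le> n" "p + q \<le> 4" "q \<le> 1" "q' \<le> 1"
  shows "\<exists>x\<in>{1..n}. \<exists>y\<in>{1..n}. x \<noteq> y \<and> c x = c y \<and> d x = d y"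
proof (rule ccontr)
  let ?Z = "\<lambda>i. {x \<in> {1..n}. c x = i}"
  assume *: "\<not> ?thesis"
  have inj: "inj_on d (?Z i)" for i by (rule inj_onI) (use * in \<open>metis (mono_tags, lifting) mem_Collect_eq\<close>)
  have sub: "d ` ?Z i \<subseteq> {..<3}" for i using colouringsD(1)[OF d] by auto
  have le: "card (?Z i) \<le> 3" for i
    using card_inj_on_le[OF inj sub finite_lessThan] by simp
  have "card (?Z 0) \<ge> 3" "card (?Z 1) \<ge> 3"
    using card_colour_0[OF c] le[of 0] n colouringsD(3)[OF c] by auto
  then have "card (d ` ?Z 0) = 3" "card (d ` ?Z 1) = 3"
    using card_image[OF inj] le by (auto simp: le_antisym)
  then have "d ` ?Z 0 = {..<3}" "d ` ?Z 1 = {..<3}"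
    by (intro card_subset_eq[OF finite_lessThan sub], simp)+
  then have "2 \<in> d ` ?Z 0" "2 \<in> d ` ?Z 1" by (simp_all only: lessThan_iff)
  then obtain x y where xy: "x \<in> ?Z 0" "y \<in> ?Z 1" "d x = 2" "d y = 2" by auto
  then have "card {x, y} \<le> card {x \<in> {1..n}. d x = 2}" by (intro card_mono) auto
  moreover have "x \<noteq> y" using xy by auto
  ultimately show False using colouringsD(4)[OF d] n by simp
qed

text \<open>The degree enters \<open>tables\<close> only through the inequality for the entry at (0,
  0). With both \<open>p + q\<close> and \<open>p' + q'\<close> at most 4 it holds automatically
  once n is at least 8.\<close>

lemma signed_tables_ge_8:
  assumes "8 \<le> n" "\<And>s p q. (s, p, q) \<in> set xs \<Longrightarrow> p + q \<le> 4"
  shows "signed_tables n xs = signed_tables 8 xs"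
proof -
  have "tables n p q p' q' = tables 8 p q p' q'" if "p + q \<le> 4" "p' + q' \<le> 4" for p q p' q'
    unfolding tables_def using assms(1) that by (intro filter_cong refl) auto
  then show ?thesis
    unfolding signed_tables_def
    by (intro arg_cong[where f = sum_list] map_cong refl) (metis assms(2) prod.collapse)
qed

text \<open>
  For \<open>n \<ge> 7\<close> the list \<open>[(1, 3, 1), (- 1, 4, 0), (- 1, 2, 1), (1, 2, 0)]\<close> is the Jacobi--Trudi expansion
  of the character of the symmetric group belonging to the partition \<open>(n - 4, 3, 1)\<close>; for
  \<open>n = 4, 5, 6\<close> the partitions are \<open>(3, 1)\<close>, \<open>(3, 2)\<close>, \<open>(3, 3)\<close>.
\<close>
lemma signed_tables_4: "signed_tables 4 [(1, 1, 0), (- 1, 0, 0)] = 1"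
  and signed_tables_5: "signed_tables 5 [(1, 2, 0), (- 1, 1, 0)] = 1"
  and signed_tables_6: "signed_tables 6 [(1, 3, 0), (- 1, 2, 0)] = 1"
  by code_simp+

lemma signed_tables_7: "signed_tables 7 [(1, 3, 1), (- 1, 4, 0), (- 1, 2, 1), (1, 2, 0)] = 1"
  by code_simp

lemma signed_tables_8: "signed_tables 8 [(1, 3, 1), (- 1, 4, 0), (- 1, 2, 1), (1, 2, 0)] = 1"
  by code_simp

section \<open>Non-real elements\<close>

text \<open>
  On the orbit of a chosen representative \<open>r\<close>, the conjugating permutation sends
  \<open>g\<^sup>k r\<close> to \<open>g\<^sup>-\<^sup>k r\<close>. Integer exponents are written as differences of natural numbers.
\<close>
lemma conjugate_to_inverse:
  fixes g :: "'a \<Rightarrow> 'a"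
  assumes g: "g permutes A"
  obtains s where "s permutes A" "s \<circ> g \<circ> inv' s = inv' g"
proof -
  have "bij g" using g by (rule permutes_bij)
  have inj: "(g ^^ i) x = (g ^^ i) y \<longleftrightarrow> x = y" for i x y
    using inj_fn[OF bij_is_inj[OF \<open>bij g\<close>], of i] by (simp add: inj_eq)
  have add: "(g ^^ i) ((g ^^ j) x) = (g ^^ (i + j)) x" for i j x by (simp add: funpow_add)
  define R where "R x y \<longleftrightarrow> (\<exists>i j. (g ^^ i) x = (g ^^ j) y)" for x y
  have R_sym: "R y x" if "R x y" for x y using that unfolding R_def by metis
  have R_trans: "R x z" if xyz: "R x y" "R y z" for x y z
  proof -
    obtain i j k l where ij: "(g ^^ i) x = (g ^^ j) y" "(g ^^ k) y = (g ^^ l) z"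
      using xyz by (auto simp: R_def)
    have "(g ^^ (k + i)) x = (g ^^ (k + j)) y" using ij(1) by (simp flip: add)
    also have "\<dots> = (g ^^ (j + l)) z" using ij(2) by (metis add add.commute)
    finally show ?thesis unfolding R_def by blast
  qed
  define r where "r x = (SOME y. R x y)" for x
  have r: "R x (r x)" for x unfolding r_def by (rule someI[of _ x]) (auto simp: R_def)
  have r_eq: "r x = r y" if "R x y" for x y
  proof -
    have "R x = R y" using that R_sym R_trans by blast
    then show ?thesis by (simp add: r_def)
  qed
  \<comment> \<open>Read with integer exponents: \<open>x\<close> is g to the power j - i applied to
    \<open>r x\<close>, and \<open>z\<close> is g to the power i - j applied to
    \<open>r x\<close>.\<close>
  define S where "S x z \<longleftrightarrow> (\<exists>i j. (g ^^ i) x = (g ^^ j) (r x) \<and> (g ^^ j) z = (g ^^ i) (r x))" for x z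
  have S_ex: "\<exists>z. S x z" for x
  proof -
    obtain i j where ij: "(g ^^ i) x = (g ^^ j) (r x)" using r[of x] by (auto simp: R_def)
    have "surj (g ^^ j)" using \<open>bij g\<close> by (simp add: bij_is_surj surj_fn)
    then obtain z where "(g ^^ j) z = (g ^^ i) (r x)" by (metis surj_def)
    with ij show ?thesis unfolding S_def by blast
  qed
  \<comment> \<open>The exponents are determined only modulo the cycle length, so two choices have
    to be compared.\<close>
  have S_unique: "z = z'" if zz': "S x z" "S x z'" for x z z'
  proof -
    obtain i j where ij: "(g ^^ i) x = (g ^^ j) (r x)" "(g ^^ j) z = (g ^^ i) (r x)"
      using zz'(1) by (auto simp: S_def)
    obtain i' j' where ij': "(g ^^ i') x = (g ^^ j') (r x)" "(g ^^ j') z' = (g ^^ i') (r x)"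
      using zz'(2) by (auto simp: S_def)
    have "(g ^^ (i' + j)) (r x) = (g ^^ (i + j')) (r x)"
      using ij(1) ij'(1) by (metis add add.commute)
    then have "(g ^^ (j + j')) z = (g ^^ (j + j')) z'"
      using ij(2) ij'(2) by (metis add add.commute)
    then show ?thesis by (simp add: inj)
  qed
  have S_sym: "S z x" if xz: "S x z" for x z
  proof -
    obtain i j where ij: "(g ^^ i) x = (g ^^ j) (r x)" "(g ^^ j) z = (g ^^ i) (r x)"
      using xz by (auto simp: S_def)
    have "R z (r x)" using ij(2) by (auto simp: R_def)
    then have "r z = r x" using r_eq R_sym R_trans r by metis
    then show ?thesis using ij unfolding S_def by metis
  qed
  define s where "s x = (THE z. S x z)" for x
  have s: "S x z \<longleftrightarrow> z = s x" for x z
    using theI'[of "S x"] S_ex S_unique unfolding s_def by metis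
  have s_s: "s (s x) = x" for x using s S_sym by metis
  have s_g: "s (g x) = inv' g (s x)" for x
  proof -
    obtain i j where ij: "(g ^^ i) x = (g ^^ j) (r x)" "(g ^^ j) (s x) = (g ^^ i) (r x)"
      using s[of x "s x"] by (auto simp: S_def)
    have "R (g x) x" unfolding R_def by (intro exI[of _ 0] exI[of _ 1]) simp
    then have rg: "r (g x) = r x" by (rule r_eq)
    have "(g ^^ i) (g x) = (g ^^ Suc j) (r (g x))" using ij(1) rg by (simp flip: funpow_swap1)
    moreover have "(g ^^ Suc j) (inv' g (s x)) = (g ^^ i) (r (g x))"
      using ij(2) rg permutes_inverses(1)[OF g] by (simp add: funpow_Suc_right del: funpow.simps)
    ultimately have "S (g x) (inv' g (s x))" unfolding S_def by blast
    then show ?thesis using s by simp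
  qed
  \<comment> \<open>A point outside \<open>A\<close> is alone in its orbit, hence its own
    representative, and is left in place.\<close>
  have "s x = x" if x: "x \<notin> A" for x
  proof -
    have fixed: "(g ^^ i) x = x" for i by (induction i) (simp_all add: permutes_not_in[OF g x])
    have "R x y \<longleftrightarrow> y = x" for y unfolding R_def fixed using fixed inj by metis
    then have "r x = x" using r[of x] by simp
    then have "S x x" by (auto simp: S_def)
    then show ?thesis using s by simp
  qed
  then have s_perm: "s permutes A" unfolding permutes_def using s_s by metis
  have "s \<circ> g \<circ> inv' s = inv' g"
  proof
    fix x
    show "(s \<circ> g \<circ> inv' s) x = inv' g x"
      using s_g[of "inv' s x"] permutes_inverses(1)[OF s_perm] by simp
  qed
  with s_perm that show ?thesis by blast
qed

lemma (in group) conj_class_eq: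
  assumes "x \<in> carrier G"
  shows "conj_class G x = (\<lambda>g. g \<otimes> x \<otimes> inv g) ` carrier G"
  using assms by (auto simp: conj_class_def orbit_def)

lemma (in group) real_element_iff:
  assumes "g \<in> carrier G"
  shows "real_element G g \<longleftrightarrow> (\<exists>h\<in>carrier G. h \<otimes> g \<otimes> inv h = inv g)"
  using assms by (auto simp: real_element_def conj_class_eq image_iff) metis

lemma (in group) real_element_inv:
  assumes g: "g \<in> carrier G" and real: "real_element G (inv g)"
  shows "real_element G g"
proof -
  obtain h where h: "h \<in> carrier G" "h \<otimes> inv g \<otimes> inv h = inv (inv g)"
    using real g by (auto simp: real_element_iff)
  then have "inv (h \<otimes> inv g \<otimes> inv h) = inv g" using g by simp
  then have "h \<otimes> g \<otimes> inv h = inv g" using g h(1) by (simp add: inv_mult_group m_assoc)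
  then show ?thesis using g h(1) by (auto simp: real_element_iff)
qed

lemma (in group) real_element_one: "real_element G \<one>"
  by (auto simp: real_element_iff)

lemma real_element_alt_group_iff:
  assumes "g \<in> carrier (alt_group n)"
  shows "real_element (alt_group n) g \<longleftrightarrow>
    (\<exists>h\<in>carrier (alt_group n). h \<circ> g \<circ> inv' h = inv' g)"
  using group.real_element_iff[OF alt_group_is_group assms] assms
  by (simp add: alt_group_mult alt_group_inv_equality)

text \<open>If \<open>s\<close> conjugates \<open>g\<close> to its inverse, so does
  \<open>s \<circ> t\<close>, and one of the two is even.\<close>

lemma odd_centraliser_imp_real:
  assumes g: "g \<in> carrier (alt_group n)"
    and t: "t permutes {1..n}" "\<not> evenperm t" "t \<circ> g = g \<circ> t"
  shows "real_element (alt_group n) g"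
proof -
  have gp: "g permutes {1..n}" using g by (simp add: alt_group_carrier)
  obtain s where s: "s permutes {1..n}" "s \<circ> g \<circ> inv' s = inv' g"
    using conjugate_to_inverse[OF gp] by blast
  show ?thesis
  proof (cases "evenperm s")
    case True
    then show ?thesis using s g by (auto simp: real_element_alt_group_iff alt_group_carrier)
  next
    case False
    have "permutation s" "permutation t" using s t permutation_permutes by blast+
    then have "evenperm (s \<circ> t)" using False t by (simp add: evenperm_comp)
    moreover have "s \<circ> t permutes {1..n}" using s t by (intro permutes_compose)
    moreover have "(s \<circ> t) \<circ> g \<circ> inv' (s \<circ> t) = inv' g"
    proof -
      have "inv' (s \<circ> t) = inv' t \<circ> inv' s" using s t by (simp add: o_inv_distrib permutes_bij)
      then have "(s \<circ> t) \<circ> g \<circ> inv' (s \<circ> t) = s \<circ> (t \<circ> g) \<circ> inv' t \<circ> inv' s" by (simp add: comp_assoc)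
      also have "\<dots> = s \<circ> g \<circ> (t \<circ> inv' t) \<circ> inv' s" by (simp only: t(3) comp_assoc)
      also have "\<dots> = inv' g" using s t by (simp add: permutes_inv_o)
      finally show ?thesis .
    qed
    ultimately show ?thesis using g by (auto simp: real_element_alt_group_iff alt_group_carrier)
  qed
qed

lemma comp_transpose:
  assumes "inj g"
  shows "g \<circ> transpose x y = transpose (g x) (g y) \<circ> g"
  using assms by (auto simp: fun_eq_iff transpose_def inj_eq)

lemma eq_insert_card:
  assumes "finite Q" "card Q = Suc (card S)" "S \<subseteq> Q"
  obtains w where "w \<notin> S" "Q = insert w S"
proof -
  have "card (Q - S) = 1" using assms by (simp add: card_Diff_subset finite_subset)
  then obtain w where "Q - S = {w}" by (rule card_1_singletonE)
  then show ?thesis using that[of w] assms(3) by auto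
qed

section \<open>Cycle structure of non-real elements\<close>

locale even_centraliser =
  fixes n :: nat and g :: "nat \<Rightarrow> nat"
  assumes perm: "g permutes {1..n}"
    and even: "t permutes {1..n} \<Longrightarrow> t \<circ> g = g \<circ> t \<Longrightarrow> evenperm t"
begin

lemma inj: "inj g" and inj_iff: "g x = g y \<longleftrightarrow> x = y"
  using permutes_inj[OF perm] by (auto simp: inj_eq)

lemma in_image: "g x \<in> {1..n} \<longleftrightarrow> x \<in> {1..n}"
  by (rule permutes_in_image[OF perm])

text \<open>The swap of two fixed points would be odd and commute with \<open>g\<close>. The next
  three lemmas likewise rule out a cycle pattern by an odd commuting permutation.\<close>

lemma fixed_point_unique:
  assumes "x \<in> {1..n}" "y \<in> {1..n}" "g x = x" "g y = y"
  shows "x = y"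
proof -
  have "evenperm (transpose x y)"
    by (rule even) (use assms in \<open>simp_all add: permutes_swap_id comp_transpose[OF inj]\<close>)
  then show ?thesis by (simp add: evenperm_swap)
qed

lemma no_2_cycle:
  assumes "x \<in> {1..n}" "g x \<noteq> x"
  shows "g (g x) \<noteq> x"
proof
  assume "g (g x) = x"
  then have "evenperm (transpose x (g x))"
    by (intro even) (use assms in_image[of x] in
      \<open>simp_all add: permutes_swap_id comp_transpose[OF inj] transpose_commute\<close>)
  then show False using assms by (simp add: evenperm_swap)
qed

lemma no_4_cycle:
  assumes x: "x \<in> {1..n}" "g x \<noteq> x"
  shows "g (g (g (g x))) \<noteq> x"
proof
  assume 4: "g (g (g (g x))) = x"
  define a b c where abc: "a = g x" "b = g (g x)" "c = g (g (g x))"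
  have mem: "a \<in> {1..n}" "b \<in> {1..n}" "c \<in> {1..n}" using x in_image by (simp_all only: abc)
  have ne: "x \<noteq> a" "x \<noteq> b" "a \<noteq> b" "b \<noteq> c" "a \<noteq> c" "x \<noteq> c"
    using x no_2_cycle[OF x] 4 unfolding abc by (metis inj_iff)+
  have gv: "g x = a" "g a = b" "g b = c" "g c = x" using 4 by (simp_all add: abc)
  \<comment> \<open>The 4-cycle of \<open>g\<close> through \<open>x\<close>, written as three
    transpositions; conjugation by \<open>g\<close> only rotates its letters.\<close>
  let ?t = "transpose x a \<circ> (transpose a b \<circ> transpose b c)"
  have "g \<circ> ?t = transpose a b \<circ> (transpose b c \<circ> transpose c x) \<circ> g"
    using comp_transpose[OF inj, of x a] comp_transpose[OF inj, of a b] comp_transpose[OF inj, of b c] gv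
    by (metis comp_assoc)
  also have "transpose a b \<circ> (transpose b c \<circ> transpose c x) = ?t"
    using ne by (auto simp: fun_eq_iff transpose_def)
  finally have "g \<circ> ?t = ?t \<circ> g" .
  then have "?t \<circ> g = g \<circ> ?t" by (rule sym)
  moreover have "?t permutes {1..n}" using x mem by (intro permutes_compose permutes_swap_id)
  ultimately have "evenperm ?t" by (rule even[rotated])
  then show False using ne by (simp add: evenperm_comp evenperm_swap permutation_compose permutation_swap_id)
qed

lemma unique_3_cycle:
  assumes x: "x \<in> {1..n}" "g x \<noteq> x" "g (g (g x)) = x"
    and y: "y \<in> {1..n}" "g y \<noteq> y" "g (g (g y)) = y"
  shows "y \<in> {x, g x, g (g x)}"
proof (rule ccontr)
  assume new: "y \<notin> {x, g x, g (g x)}"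
  define a b c d where abcd: "a = g x" "b = g (g x)" "c = g y" "d = g (g y)"
  have mem: "a \<in> {1..n}" "b \<in> {1..n}" "c \<in> {1..n}" "d \<in> {1..n}"
    using x(1) y(1) in_image by (simp_all only: abcd)
  have gv: "g x = a" "g a = b" "g b = x" "g y = c" "g c = d" "g d = y"
    using x y by (simp_all add: abcd)
  have ne: "x \<noteq> a" "x \<noteq> b" "y \<noteq> c" "y \<noteq> d" "x \<noteq> y" "a \<noteq> y" "b \<noteq> y"
    using x(2) y(2) no_2_cycle[OF x(1,2)] no_2_cycle[OF y(1,2)] new by (simp_all only: abcd) auto
  have ne': "a \<noteq> b" "c \<noteq> d" "x \<noteq> c" "a \<noteq> c" "b \<noteq> c"
    using ne gv inj_iff by metis+
  have ne'': "x \<noteq> d" "a \<noteq> d" "b \<noteq> d"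
    using ne' gv inj_iff by metis+
  note ne = ne ne' ne''
  \<comment> \<open>This exchanges the two 3-cycles position by position. It is odd, being a product
    of three transpositions, and commutes with \<open>g\<close>.\<close>
  let ?t = "transpose x y \<circ> (transpose a c \<circ> transpose b d)"
  have "g \<circ> ?t = transpose a c \<circ> (transpose b d \<circ> transpose x y) \<circ> g"
    using comp_transpose[OF inj, of x y] comp_transpose[OF inj, of a c] comp_transpose[OF inj, of b d] gv
    by (metis comp_assoc)
  also have "transpose a c \<circ> (transpose b d \<circ> transpose x y) = ?t"
    using ne by (auto simp: fun_eq_iff transpose_def)
  finally have "g \<circ> ?t = ?t \<circ> g" .
  then have "?t \<circ> g = g \<circ> ?t" by (rule sym)
  moreover have "?t permutes {1..n}" using x(1) y(1) mem by (intro permutes_compose permutes_swap_id)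
  ultimately have "evenperm ?t" by (rule even[rotated])
  then show False using ne by (simp add: evenperm_comp evenperm_swap permutation_compose permutation_swap_id)
qed

text \<open>Two fixed points or a 2-cycle, both excluded. Invariant sets matter because they are the
  possible colour classes of a colouring fixed by \<open>g\<close>.\<close>

lemma no_invariant_2_set:
  assumes Q: "Q \<subseteq> {1..n}" "card Q = 2" and inv: "\<And>x. x \<in> Q \<Longrightarrow> g x \<in> Q"
  shows False
proof -
  obtain x y where xy: "Q = {x, y}" "x \<noteq> y" using Q(2) by (auto simp: card_2_iff)
  have mem: "x \<in> {1..n}" "y \<in> {1..n}" using Q(1) xy by auto
  have "g x = x \<or> g x = y" "g y = x \<or> g y = y" using inv xy by auto
  then show False
    using fixed_point_unique[OF mem] no_2_cycle[OF mem(1)] xy(2) inj_iff by metis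
qed

text \<open>With at most one fixed point and no 2-cycle, only a single 3-cycle remains.\<close>

lemma invariant_3_set:
  assumes Q: "Q \<subseteq> {1..n}" "card Q = 3" and inv: "\<And>x. x \<in> Q \<Longrightarrow> g x \<in> Q"
  shows "\<exists>x\<in>Q. g x \<noteq> x \<and> g (g (g x)) = x \<and> Q = {x, g x, g (g x)}"
proof -
  have fin: "finite Q" using Q(1) finite_subset by blast
  have "\<exists>x\<in>Q. g x \<noteq> x"
  proof (rule ccontr)
    assume "\<not> ?thesis"
    then have "card Q \<le> 1" using Q(1) fixed_point_unique fin
      by (metis (no_types, lifting) One_nat_def card_le_Suc0_iff_eq subset_iff)
    then show False using Q(2) by simp
  qed
  then obtain x where x: "x \<in> Q" "g x \<noteq> x" by blast
  have x': "x \<in> {1..n}" using x Q(1) by auto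
  have ne: "g (g x) \<noteq> x" "g (g x) \<noteq> g x" using no_2_cycle[OF x' x(2)] x(2) by (auto simp: inj_iff)
  have "{x, g x, g (g x)} \<subseteq> Q" using x inv by auto
  moreover have "card {x, g x, g (g x)} = 3" using ne x(2) by auto
  ultimately have eq: "Q = {x, g x, g (g x)}" using card_subset_eq[OF fin] Q(2) by metis
  have "g (g (g x)) \<in> Q" using x inv by auto
  then have "g (g (g x)) = x" using eq ne x(2) by (auto simp: inj_iff)
  with x eq show ?thesis by blast
qed

text \<open>Without a fixed point the set would be a 4-cycle or two 2-cycles.\<close>

lemma invariant_4_set:
  assumes Q: "Q \<subseteq> {1..n}" "card Q = 4" and inv: "\<And>x. x \<in> Q \<Longrightarrow> g x \<in> Q"
  shows "\<exists>x\<in>Q. g x = x"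
proof (rule ccontr)
  assume no_fix: "\<not> ?thesis"
  have fin: "finite Q" using Q(1) finite_subset by blast
  obtain x where x: "x \<in> Q" using Q(2) by fastforce
  have x': "x \<in> {1..n}" "g x \<noteq> x" using x Q(1) no_fix by auto
  have ne: "g (g x) \<noteq> x" "g (g x) \<noteq> g x" using no_2_cycle[OF x'] x'(2) by (auto simp: inj_iff)
  have "{x, g x, g (g x)} \<subseteq> Q" using x inv by auto
  moreover have "card {x, g x, g (g x)} = 3" using ne x'(2) by auto
  ultimately obtain w where w: "w \<notin> {x, g x, g (g x)}" "Q = insert w {x, g x, g (g x)}"
    using eq_insert_card[OF fin, of "{x, g x, g (g x)}"] Q(2) by auto
  have "g w \<in> Q" "g w \<noteq> w" using inv w(2) no_fix by auto
  moreover have "g w \<noteq> g x" "g w \<noteq> g (g x)" using w(1) by (auto simp: inj_iff)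
  ultimately have gw: "g w = x" using w(2) by auto
  have "g (g (g x)) \<in> Q" using x inv by auto
  then consider "g (g (g x)) = x" | "g (g (g x)) = w" using w(2) ne x'(2) by (auto simp: inj_iff)
  then show False
  proof cases
    case 1
    then have "g w = g (g (g x))" using gw by simp
    then show False using w(1) by (simp add: inj_iff)
  next
    case 2
    then show False using gw no_4_cycle[OF x'] by simp
  qed
qed

end

lemma not_real_imp_even_centraliser:
  assumes "g \<in> carrier (alt_group n)" "\<not> real_element (alt_group n) g"
  shows "even_centraliser n g"
  by unfold_locales (use assms odd_centraliser_imp_real in \<open>auto simp: alt_group_carrier\<close>)

section \<open>The vanishing character\<close>

lemma recolour_eq_iff:
  assumes "g permutes {1..n}"
  shows "recolour g c = c \<longleftrightarrow> (\<forall>x. c (g x) = c x)"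
  unfolding recolour_def fun_eq_iff o_apply using permutes_inverses[OF assms] by metis

lemma colourings_update:
  assumes c: "c \<in> colourings n p q" and y: "y \<in> {1..n}"
  shows "c y = 2 \<Longrightarrow> c(y := 1) \<in> colourings n (p + 1) (q - 1)"
    and "c y = 1 \<Longrightarrow> c(y := 2) \<in> colourings n (p - 1) (q + 1)"
    and "c y = 0 \<Longrightarrow> c(y := 1) \<in> colourings n (p + 1) q"
    and "c y = 1 \<Longrightarrow> c(y := 0) \<in> colourings n (p - 1) q"
proof -
  have upd: "{x \<in> {1..n}. (c(y := k)) x = i} =
      (if i = k then insert y {x \<in> {1..n}. c x = i} else {x \<in> {1..n}. c x = i} - {y})" for k i
    using y by auto
  have ext: "c(y := k) \<in> {1..n} \<rightarrow>\<^sub>E {..<3}" if "k < 3" for k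
    using c y that by (auto simp: colourings_def PiE_def extensional_def)
  note [simp] = card_insert_if card_Diff_singleton_if
  show "c y = 2 \<Longrightarrow> c(y := 1) \<in> colourings n (p + 1) (q - 1)"
    and "c y = 1 \<Longrightarrow> c(y := 2) \<in> colourings n (p - 1) (q + 1)"
    and "c y = 0 \<Longrightarrow> c(y := 1) \<in> colourings n (p + 1) q"
    and "c y = 1 \<Longrightarrow> c(y := 0) \<in> colourings n (p - 1) q"
    using c y ext[of 0] ext[of 1] ext[of 2] unfolding colourings_def mem_Collect_eq upd by simp_all
qed

context even_centraliser
begin

abbreviation fixed_colourings :: "nat \<Rightarrow> nat \<Rightarrow> (nat \<Rightarrow> nat) set" where
  "fixed_colourings p q \<equiv> {c \<in> colourings n p q. recolour g c = c}"

lemma fixed_colouring_apply: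
  "c \<in> fixed_colourings p q \<Longrightarrow> c (g x) = c x"
  using recolour_eq_iff[OF perm] by blast

lemma fixed_colouring_class:
  "c \<in> fixed_colourings p q \<Longrightarrow> x \<in> {x \<in> {1..n}. c x = i} \<Longrightarrow> g x \<in> {x \<in> {1..n}. c x = i}"
  using fixed_colouring_apply[of c p q x] in_image[of x] by simp

lemma fixed_colouring_update:
  assumes "c \<in> fixed_colourings p q" "g y = y"
  shows "recolour g (c(y := k)) = c(y := k)"
proof -
  have "g x = y \<longleftrightarrow> x = y" for x using assms(2) inj_iff by metis
  then show ?thesis using fixed_colouring_apply[OF assms(1)] by (simp add: recolour_eq_iff[OF perm])
qed

lemma fixed_colouring_singleton:
  assumes c: "c \<in> fixed_colourings p q" and 1: "card {x \<in> {1..n}. c x = i} = 1"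
  obtains y where "y \<in> {1..n}" "g y = y" "{x \<in> {1..n}. c x = i} = {y}"
proof -
  obtain y where y: "{x \<in> {1..n}. c x = i} = {y}" using 1 by (rule card_1_singletonE)
  then have "g y \<in> {y}" using fixed_colouring_class[OF c, of y i] by simp
  moreover have "y \<in> {1..n}" using y by blast
  ultimately show ?thesis using y that by simp
qed

text \<open>Makes the terms (2, 1) and (2, 0) of the expansions vanish one by one.\<close>

lemma fixed_colourings_2: "fixed_colourings 2 q = {}"
proof (rule equals0I)
  fix c assume c: "c \<in> fixed_colourings 2 q"
  then have "card {x \<in> {1..n}. c x = 1} = 2" using colouringsD(3) by blast
  then show False
    using no_invariant_2_set[of "{x \<in> {1..n}. c x = 1}"] fixed_colouring_class[OF c] by blast
qed

text \<open>Both colour classes would be 3-cycles, but \<open>g\<close> has at most one.\<close>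

lemma fixed_colourings_3:
  assumes "n = 6"
  shows "fixed_colourings 3 0 = {}"
proof (rule equals0I)
  fix c assume c: "c \<in> fixed_colourings 3 0"
  then have cc: "c \<in> colourings n 3 0" by simp
  let ?Q = "\<lambda>i. {x \<in> {1..n}. c x = i}"
  have "card (?Q 1) = 3" "card (?Q 0) = 3"
    using colouringsD(3)[OF cc] card_colour_0[OF cc] assms by simp_all
  then obtain x y where x: "x \<in> ?Q 1" "g x \<noteq> x" "g (g (g x)) = x" "?Q 1 = {x, g x, g (g x)}"
    and y: "y \<in> ?Q 0" "g y \<noteq> y" "g (g (g y)) = y"
    using invariant_3_set[of "?Q 1"] invariant_3_set[of "?Q 0"] fixed_colouring_class[OF c] by blast
  have "y \<in> ?Q 1" unfolding x(4) by (rule unique_3_cycle) (use x(1-3) y in auto)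
  then show False using y(1) by simp
qed

text \<open>The point of colour 1 is fixed, and the invariant set of the other four contains a
  second fixed point.\<close>

lemma fixed_colourings_1:
  assumes "n = 5"
  shows "fixed_colourings 1 0 = {}"
proof (rule equals0I)
  fix c assume c: "c \<in> fixed_colourings 1 0"
  then have cc: "c \<in> colourings n 1 0" by simp
  let ?Q = "\<lambda>i. {x \<in> {1..n}. c x = i}"
  obtain y where y: "y \<in> {1..n}" "g y = y" "?Q 1 = {y}"
    using fixed_colouring_singleton[OF c colouringsD(3)[OF cc]] by blast
  have "card (?Q 0) = 4" using card_colour_0[OF cc] assms by simp
  then obtain z where z: "z \<in> ?Q 0" "g z = z"
    using invariant_4_set[of "?Q 0"] fixed_colouring_class[OF c] by blast
  then have "z = y" using fixed_point_unique y by blast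
  then show False using y z by auto
qed

lemma card_eq_by_update:
  assumes "\<And>c. c \<in> A \<Longrightarrow> c y = k \<and> c(y := l) \<in> B" "\<And>c. c \<in> B \<Longrightarrow> c y = l \<and> c(y := k) \<in> A"
  shows "card A = card B"
proof (rule bij_betw_same_card)
  show "bij_betw (\<lambda>c. c(y := l)) A B"
    by (rule bij_betw_byWitness[of _ "\<lambda>c. c(y := k)"]) (use assms in \<open>auto simp: fun_eq_iff\<close>)
qed

text \<open>The single point of colour 2, and some point of the 4-set of colour 1, must be the
  unique fixed point of \<open>g\<close>. Switching its colour between 2 and 1 is a bijection; if
  \<open>g\<close> has no fixed point, both sides are empty.\<close>

lemma card_fixed_colourings_4: "card (fixed_colourings 3 1) = card (fixed_colourings 4 0)"
proof (cases "\<exists>y\<in>{1..n}. g y = y")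
  case True
  then obtain y where y: "y \<in> {1..n}" "g y = y" by blast
  show ?thesis
  proof (rule card_eq_by_update)
    fix c assume c: "c \<in> fixed_colourings 3 1"
    then have cc: "c \<in> colourings n 3 1" by simp
    obtain z where z: "z \<in> {1..n}" "g z = z" "{x \<in> {1..n}. c x = 2} = {z}"
      using fixed_colouring_singleton[OF c colouringsD(4)[OF cc]] by blast
    then have "z = y" using fixed_point_unique y by blast
    then have "c y = 2" using z by blast
    then show "c y = 2 \<and> c(y := 1) \<in> fixed_colourings 4 0"
      using colourings_update(1)[OF cc y(1)] fixed_colouring_update[OF c y(2)] by simp
  next
    fix c assume c: "c \<in> fixed_colourings 4 0"
    then have cc: "c \<in> colourings n 4 0" by simp
    obtain z where z: "z \<in> {x \<in> {1..n}. c x = 1}" "g z = z"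
      using invariant_4_set[of "{x \<in> {1..n}. c x = 1}"] fixed_colouring_class[OF c] colouringsD(3)[OF cc] by blast
    then have "z = y" using fixed_point_unique y by blast
    then have "c y = 1" using z by blast
    then show "c y = 1 \<and> c(y := 2) \<in> fixed_colourings 3 1"
      using colourings_update(2)[OF cc y(1)] fixed_colouring_update[OF c y(2)] by simp
  qed
next
  case False
  have "fixed_colourings 3 1 = {}"
  proof (rule equals0I)
    fix c assume c: "c \<in> fixed_colourings 3 1"
    then have "card {x \<in> {1..n}. c x = 2} = 1" using colouringsD(4) by blast
    then show False using fixed_colouring_singleton[OF c] False by metis
  qed
  moreover have "fixed_colourings 4 0 = {}"
  proof (rule equals0I)
    fix c assume c: "c \<in> fixed_colourings 4 0"
    then have "card {x \<in> {1..n}. c x = 1} = 4" using colouringsD(3) by blast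
    then show False
      using invariant_4_set[of "{x \<in> {1..n}. c x = 1}"] fixed_colouring_class[OF c] False by blast
  qed
  ultimately show ?thesis by (simp only:)
qed

text \<open>Here the whole of \<open>{1..4}\<close> is an invariant 4-set, so \<open>g\<close> has
  exactly one fixed point, and switching its colour between 1 and 0 is a bijection.\<close>

lemma card_fixed_colourings_1:
  assumes "n = 4"
  shows "card (fixed_colourings 1 0) = card (fixed_colourings 0 0)"
proof -
  obtain y where y: "y \<in> {1..n}" "g y = y"
    using invariant_4_set[of "{1..n}"] assms in_image by auto
  show ?thesis
  proof (rule card_eq_by_update)
    fix c assume c: "c \<in> fixed_colourings 1 0"
    then have cc: "c \<in> colourings n 1 0" by simp
    obtain z where z: "z \<in> {1..n}" "g z = z" "{x \<in> {1..n}. c x = 1} = {z}"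
      using fixed_colouring_singleton[OF c colouringsD(3)[OF cc]] by blast
    then have "z = y" using fixed_point_unique y by blast
    then have "c y = 1" using z by blast
    then show "c y = 1 \<and> c(y := 0) \<in> fixed_colourings 0 0"
      using colourings_update(4)[OF cc y(1)] fixed_colouring_update[OF c y(2)] by simp
  next
    fix c assume c: "c \<in> fixed_colourings 0 0"
    then have cc: "c \<in> colourings n 0 0" by simp
    have "{x \<in> {1..n}. c x = 1} = {}" "{x \<in> {1..n}. c x = 2} = {}"
      using colouringsD(3,4)[OF cc] by simp_all
    then have "c y \<noteq> 1" "c y \<noteq> 2" using y(1) by blast+
    then have "c y = 0" using colouringsD(1)[OF cc y(1)] by simp
    then show "c y = 0 \<and> c(y := 1) \<in> fixed_colourings 1 0"
      using colourings_update(3)[OF cc y(1)] fixed_colouring_update[OF c y(2)] by simp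
  qed
qed

end

lemma irreducible_character_two_colours:
  assumes xs: "\<And>s p q. (s, p, q) \<in> set xs \<Longrightarrow> q = 0 \<and> p + 3 \<le> n"
    and norm: "signed_tables n xs = 1"
  obtains \<chi> where "irreducible_character (alt_group n) \<chi>"
    "\<And>g. g \<in> carrier (alt_group n) \<Longrightarrow> signed_char n xs g = 0 \<Longrightarrow> \<chi> g = 0"
proof (rule irreducible_character_signed_char[OF _ _ norm])
  show "p + q \<le> n" if "(s, p, q) \<in> set xs" for s p q using xs[OF that] by simp
  show "\<exists>x\<in>{1..n}. \<exists>y\<in>{1..n}. x \<noteq> y \<and> c x = c y \<and> d x = d y"
    if "(s, p, q) \<in> set xs" "(s', p', q') \<in> set xs" "c \<in> colourings n p q" "d \<in> colourings n p' q'"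
    for s p q s' p' q' c d
    using xs[OF that(1)] xs[OF that(2)] that(3,4) repeated_colours_two by blast
qed (rule that)

lemma irreducible_character_vanishing_on_non_real:
  assumes n: "4 \<le> n"
  obtains \<chi> where "irreducible_character (alt_group n) \<chi>"
    "\<And>g. g \<in> carrier (alt_group n) \<Longrightarrow> \<not> real_element (alt_group n) g \<Longrightarrow> \<chi> g = 0"
proof -
  consider "n = 4" | "n = 5" | "n = 6" | "7 \<le> n" using n by linarith
  then have "\<exists>\<chi>. irreducible_character (alt_group n) \<chi> \<and>
    (\<forall>g\<in>carrier (alt_group n). \<not> real_element (alt_group n) g \<longrightarrow> \<chi> g = 0)"
  proof cases
    case 1
    let ?xs = "[(1, 1, 0), (- 1, 0, 0)] :: (int \<times> nat \<times> nat) list"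
    have "signed_char n ?xs g = 0"
      if "g \<in> carrier (alt_group n)" "\<not> real_element (alt_group n) g" for g
      using even_centraliser.card_fixed_colourings_1[OF not_real_imp_even_centraliser[OF that] 1]
      by (simp add: signed_char_def fix_char_def del: Collect_empty_eq)
    moreover obtain \<chi> where "irreducible_character (alt_group n) \<chi>"
      "\<And>g. g \<in> carrier (alt_group n) \<Longrightarrow> signed_char n ?xs g = 0 \<Longrightarrow> \<chi> g = 0"
      by (rule irreducible_character_two_colours[of ?xs n]) (use 1 signed_tables_4 in auto)
    ultimately show ?thesis by blast
  next
    case 2
    let ?xs = "[(1, 2, 0), (- 1, 1, 0)] :: (int \<times> nat \<times> nat) list"
    have "signed_char n ?xs g = 0"
      if "g \<in> carrier (alt_group n)" "\<not> real_element (alt_group n) g" for g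
      using even_centraliser.fixed_colourings_1[OF not_real_imp_even_centraliser[OF that] 2]
        even_centraliser.fixed_colourings_2[OF not_real_imp_even_centraliser[OF that]]
      by (simp add: signed_char_def fix_char_def del: Collect_empty_eq)
    moreover obtain \<chi> where "irreducible_character (alt_group n) \<chi>"
      "\<And>g. g \<in> carrier (alt_group n) \<Longrightarrow> signed_char n ?xs g = 0 \<Longrightarrow> \<chi> g = 0"
      by (rule irreducible_character_two_colours[of ?xs n]) (use 2 signed_tables_5 in auto)
    ultimately show ?thesis by blast
  next
    case 3
    let ?xs = "[(1, 3, 0), (- 1, 2, 0)] :: (int \<times> nat \<times> nat) list"
    have "signed_char n ?xs g = 0"
      if "g \<in> carrier (alt_group n)" "\<not> real_element (alt_group n) g" for g
      using even_centraliser.fixed_colourings_3[OF not_real_imp_even_centraliser[OF that] 3]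
        even_centraliser.fixed_colourings_2[OF not_real_imp_even_centraliser[OF that]]
      by (simp add: signed_char_def fix_char_def del: Collect_empty_eq)
    moreover obtain \<chi> where "irreducible_character (alt_group n) \<chi>"
      "\<And>g. g \<in> carrier (alt_group n) \<Longrightarrow> signed_char n ?xs g = 0 \<Longrightarrow> \<chi> g = 0"
      by (rule irreducible_character_two_colours[of ?xs n]) (use 3 signed_tables_6 in auto)
    ultimately show ?thesis by blast
  next
    case 4
    let ?xs = "[(1, 3, 1), (- 1, 4, 0), (- 1, 2, 1), (1, 2, 0)] :: (int \<times> nat \<times> nat) list"
    have "signed_char n ?xs g = 0"
      if "g \<in> carrier (alt_group n)" "\<not> real_element (alt_group n) g" for g
      using even_centraliser.card_fixed_colourings_4[OF not_real_imp_even_centraliser[OF that]]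
        even_centraliser.fixed_colourings_2[OF not_real_imp_even_centraliser[OF that]]
      by (simp add: signed_char_def fix_char_def del: Collect_empty_eq)
    moreover obtain \<chi> where "irreducible_character (alt_group n) \<chi>"
      "\<And>g. g \<in> carrier (alt_group n) \<Longrightarrow> signed_char n ?xs g = 0 \<Longrightarrow> \<chi> g = 0"
    proof (rule irreducible_character_signed_char[of ?xs n])
      show "p + q \<le> n" if "(s, p, q) \<in> set ?xs" for s p q using that 4 by auto
      show "\<exists>x\<in>{1..n}. \<exists>y\<in>{1..n}. x \<noteq> y \<and> c x = c y \<and> d x = d y"
        if "(s, p, q) \<in> set ?xs" "(s', p', q') \<in> set ?xs" "c \<in> colourings n p q" "d \<in> colourings n p' q'"
        for s p q s' p' q' c d
        by (rule repeated_colours_three[OF that(3,4) 4]) (use that(1,2) in auto)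
      \<comment> \<open>The value at 7 lies below the stable range and is evaluated
        separately.\<close>
      have "signed_tables n ?xs = signed_tables 8 ?xs" if "8 \<le> n"
        by (rule signed_tables_ge_8[OF that]) auto
      then show "signed_tables n ?xs = 1"
        using 4 signed_tables_7 signed_tables_8 by (cases "n = 7") auto
    qed blast
    ultimately show ?thesis by blast
  qed
  then show ?thesis using that by blast
qed

section \<open>Singularity and generation\<close>

lemma (in group) sum_irreducible_eq_0:
  assumes \<rho>: "irreducible_representation G d \<rho>"
    and H: "H \<subseteq> carrier G" "\<And>g h. g \<in> carrier G \<Longrightarrow> h \<in> H \<Longrightarrow> g \<otimes> h \<otimes> inv g \<in> H"
    and 0: "\<And>h. h \<in> H \<Longrightarrow> mat_trace (\<rho> h) = 0"
    and ij: "i < d" "j < d"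
  shows "(\<Sum>h\<in>H. \<rho> h $$ (i, j)) = 0"
proof -
  note \<rho>' = irreducible_representationD[OF is_group \<rho>]
  have c: "\<rho> g \<in> carrier_mat d d" if "g \<in> carrier G" for g using \<rho>'(1) that by (auto simp: mat_rep_def)
  define S where "S = Matrix.mat d d (\<lambda>(i, j). \<Sum>h\<in>H. \<rho> h $$ (i, j))"
  have S: "S \<in> carrier_mat d d" by (simp add: S_def)
  have "\<rho> g * S = S * \<rho> g" if g: "g \<in> carrier G" for g
  proof (rule eq_matI)
    fix i j assume "i < dim_row (S * \<rho> g)" "j < dim_col (S * \<rho> g)"
    then have ij: "i < d" "j < d" using S c[OF g] by auto
    have "(\<rho> g * S) $$ (i, j) = (\<Sum>m<d. \<rho> g $$ (i, m) * (\<Sum>h\<in>H. \<rho> h $$ (m, j)))"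
      using c[OF g] ij by (auto simp: S_def scalar_prod_def lessThan_atLeast0 intro!: sum.cong)
    also have "\<dots> = (\<Sum>h\<in>H. \<Sum>m<d. \<rho> g $$ (i, m) * \<rho> h $$ (m, j))"
      by (simp add: sum_distrib_left) (rule sum.swap)
    also have "\<dots> = (\<Sum>h\<in>H. \<rho> (g \<otimes> h) $$ (i, j))"
      using g H(1) ij by (auto simp: mult_index[OF \<rho>'(1)] intro!: sum.cong)
    \<comment> \<open>Conjugation by \<open>g\<close> permutes \<open>H\<close>, which moves the
      factor \<open>g\<close> from the left to the right.\<close>
    also have "\<dots> = (\<Sum>h\<in>H. \<rho> ((g \<otimes> h \<otimes> inv g) \<otimes> g) $$ (i, j))"
      using g H(1) by (intro sum.cong refl) (simp add: m_assoc subset_iff)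
    also have "\<dots> = (\<Sum>h\<in>H. \<rho> (h \<otimes> g) $$ (i, j))"
    proof (rule sum.reindex_bij_betw[of "\<lambda>h. g \<otimes> h \<otimes> inv g" H H "\<lambda>h. \<rho> (h \<otimes> g) $$ (i, j)"])
      have cancel: "inv g \<otimes> (g \<otimes> x) = x" "g \<otimes> (inv g \<otimes> x) = x" if "x \<in> carrier G" for x
        using g that by (simp_all flip: m_assoc)
      have "inv g \<otimes> h \<otimes> g \<in> H" if "h \<in> H" for h using H(2)[of "inv g" h] g that by simp
      then show "bij_betw (\<lambda>h. g \<otimes> h \<otimes> inv g) H H"
        by (intro bij_betw_byWitness[of _ "\<lambda>h. inv g \<otimes> h \<otimes> g"])
          (use g H in \<open>auto simp: m_assoc subset_iff cancel\<close>)
    qed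
    also have "\<dots> = (\<Sum>h\<in>H. \<Sum>m<d. \<rho> h $$ (i, m) * \<rho> g $$ (m, j))"
      using g H(1) ij by (auto simp: mult_index[OF \<rho>'(1)] intro!: sum.cong)
    also have "\<dots> = (\<Sum>m<d. (\<Sum>h\<in>H. \<rho> h $$ (i, m)) * \<rho> g $$ (m, j))"
      by (simp add: sum_distrib_right) (rule sum.swap)
    also have "\<dots> = (S * \<rho> g) $$ (i, j)"
      using c[OF g] ij by (auto simp: S_def scalar_prod_def lessThan_atLeast0 intro!: sum.cong)
    finally show "(\<rho> g * S) $$ (i, j) = (S * \<rho> g) $$ (i, j)" .
  qed (use S c[OF g] in auto)
  then obtain a where a: "S = a \<cdot>\<^sub>m 1\<^sub>m d" using schur_scalar[OF is_group \<rho> S] by blast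
  have "of_nat d * a = mat_trace S" by (simp add: a mat_trace_def)
  also have "\<dots> = (\<Sum>h\<in>H. \<Sum>i<d. \<rho> h $$ (i, i))"
    unfolding S_def mat_trace_def by simp (rule sum.swap)
  also have "\<dots> = (\<Sum>h\<in>H. mat_trace (\<rho> h))"
    using c H(1) by (intro sum.cong refl) (auto simp: mat_trace_def dest!: subsetD)
  also have "\<dots> = 0" using 0 by simp
  finally have "a = 0" using \<rho>'(2) by simp
  then have "S $$ (i, j) = 0" using a ij by simp
  then show ?thesis using ij by (simp add: S_def)
qed

lemma (in group) singular_cayley_graph:
  assumes fin: "finite (carrier G)" and \<chi>: "irreducible_character G \<chi>"
    and H: "H \<subseteq> carrier G" "\<And>g h. g \<in> carrier G \<Longrightarrow> h \<in> H \<Longrightarrow> g \<otimes> h \<otimes> inv g \<in> H" "\<one> \<notin> H"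
    and 0: "\<And>h. h \<in> H \<Longrightarrow> \<chi> h = 0"
  shows "singular_graph (cayley_graph G H)"
proof -
  let ?\<Gamma> = "cayley_graph G H"
  obtain d \<rho> where \<rho>: "irreducible_representation G d \<rho>" and \<chi>\<rho>: "\<chi> = (\<lambda>g\<in>carrier G. mat_trace (\<rho> g))"
    using \<chi> by (auto simp: irreducible_character_def)
  note \<rho>' = irreducible_representationD[OF is_group \<rho>]
  have tr0: "mat_trace (\<rho> h) = 0" if "h \<in> H" for h using 0[OF that] H(1) that by (auto simp: \<chi>\<rho>)
  \<comment> \<open>The adjacency matrix is real, so the real part of a matrix coefficient is taken.
    The diagonal position (0, 0) gives value 1 at the identity, so the kernel vector is
    nonzero.\<close>
  define f where "f u = Re (\<rho> u $$ (0, 0))" for u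
  have f1: "f \<one> = 1" using \<rho>'(1,2) by (simp add: f_def mat_rep_def)
  have sum0: "(\<Sum>h\<in>H. f (h \<otimes> u)) = 0" if u: "u \<in> carrier G" for u
  proof -
    have "(\<Sum>h\<in>H. \<rho> (h \<otimes> u) $$ (0, 0)) = (\<Sum>h\<in>H. \<Sum>m<d. \<rho> h $$ (0, m) * \<rho> u $$ (m, 0))"
      using u H(1) \<rho>'(2) by (intro sum.cong refl mult_index[OF \<rho>'(1)]) auto
    also have "\<dots> = (\<Sum>m<d. (\<Sum>h\<in>H. \<rho> h $$ (0, m)) * \<rho> u $$ (m, 0))"
      by (simp add: sum_distrib_right) (rule sum.swap)
    also have "\<dots> = 0"
      using sum_irreducible_eq_0[OF \<rho> H(1,2) tr0 \<rho>'(2)] by simp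
    finally have "Re (\<Sum>h\<in>H. \<rho> (h \<otimes> u) $$ (0, 0)) = 0" by (simp only: zero_complex.sel)
    then show ?thesis by (simp only: f_def Re_sum)
  qed
  have "\<not> invertible_mat (adjacency_matrix ?\<Gamma> vs)" if vs: "distinct vs" "set vs = carrier G" for vs
  proof
    define N where "N = length vs"
    let ?A = "adjacency_matrix ?\<Gamma> vs"
    have A: "?A \<in> carrier_mat N N" by (simp add: adjacency_matrix_def N_def)
    assume "invertible_mat ?A"
    then obtain B where B: "inverts_mat ?A B" "inverts_mat B ?A" by (auto simp: invertible_mat_def)
    \<comment> \<open>The equations for \<open>B\<close> come without its dimensions, which are read
      off from the two identity matrices.\<close>
    have "dim_col (?A * B) = N" "dim_col (B * ?A) = dim_row B"
      using B A unfolding inverts_mat_def by simp_all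
    then have "dim_col B = N" "dim_row B = N" using A by auto
    then have Bc: "B \<in> carrier_mat N N" by auto
    define v where "v = vec N (\<lambda>i. f (vs ! i))"
    have v: "v \<in> carrier_vec N" by (simp add: v_def)
    have "?A *\<^sub>v v = 0\<^sub>v N"
    proof (rule eq_vecI)
      fix i assume "i < dim_vec (0\<^sub>v N :: real vec)"
      then have i: "i < N" by simp
      let ?u = "vs ! i"
      have u: "?u \<in> carrier G" using nth_mem[of i vs] i vs(2) by (simp add: N_def)
      have bij: "bij_betw (\<lambda>j. vs ! j) {..<N} (carrier G)"
        by (rule bij_betw_nth[OF vs(1)]) (simp_all add: N_def vs(2))
      have "(?A *\<^sub>v v) $ i = (\<Sum>j<N. (if (?u, vs ! j) \<in> parcs ?\<Gamma> then 1 else 0) * f (vs ! j))"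
        using i by (simp add: adjacency_matrix_def v_def N_def scalar_prod_def lessThan_atLeast0)
      also have "\<dots> = (\<Sum>w\<in>carrier G. (if (?u, w) \<in> parcs ?\<Gamma> then 1 else 0) * f w)"
        by (rule sum.reindex_bij_betw[OF bij])
      also have "\<dots> = (\<Sum>w\<in>carrier G. if (?u, w) \<in> parcs ?\<Gamma> then f w else 0)"
        by (intro sum.cong refl) simp
      also have "\<dots> = (\<Sum>w\<in>{w \<in> carrier G. (?u, w) \<in> parcs ?\<Gamma>}. f w)"
        by (rule sum.inter_filter[OF fin, symmetric])
      \<comment> \<open>The graph has no loops; as \<open>\<one> \<notin> H\<close>, excluding them
        loses no neighbour.\<close>
      also have "{w \<in> carrier G. (?u, w) \<in> parcs ?\<Gamma>} = (\<lambda>h. h \<otimes> ?u) ` H"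
      proof -
        have "h \<otimes> ?u \<noteq> ?u" if "h \<in> H" for h
        proof -
          have hG: "h \<in> carrier G" using that H(1) by blast
          show ?thesis using r_cancel_one[OF u hG] that H(3) by auto
        qed
        note neq = this[symmetric]
        have "w \<in> (\<lambda>h. h \<otimes> ?u) ` H \<longleftrightarrow> w \<in> carrier G \<and> (?u, w) \<in> parcs ?\<Gamma>" for w
          unfolding cayley_graph_def using u H(1) neq by (auto simp del: r_cancel_one r_cancel_one')
        then show ?thesis by blast
      qed
      also have "(\<Sum>w\<in>(\<lambda>h. h \<otimes> ?u) ` H. f w) = (\<Sum>h\<in>H. f (h \<otimes> ?u))"
      proof (rule sum.reindex[unfolded o_def])
        show "inj_on (\<lambda>h. h \<otimes> ?u) H"
        proof (rule inj_onI)
          fix h k assume "h \<in> H" "k \<in> H" "h \<otimes> ?u = k \<otimes> ?u"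
          then show "h = k" using right_cancel[of ?u h k] u H(1) by blast
        qed
      qed
      also have "\<dots> = 0" by (rule sum0[OF u])
      finally show "(?A *\<^sub>v v) $ i = 0\<^sub>v N $ i" using i by simp
    qed (use A in simp)
    moreover have "B *\<^sub>v (?A *\<^sub>v v) = (B * ?A) *\<^sub>v v"
      using A Bc v by (simp add: assoc_mult_mat_vec[of _ N N _ N])
    moreover have "(B * ?A) *\<^sub>v v = v" using B(2) Bc v by (simp add: inverts_mat_def)
    moreover have "B *\<^sub>v 0\<^sub>v N = 0\<^sub>v N" using Bc by (intro eq_vecI) auto
    ultimately have v0: "v = 0\<^sub>v N" by simp
    obtain i where "i < N" "vs ! i = \<one>" using vs(2) one_closed by (metis N_def in_set_conv_nth)
    then have "v $ i = 1" using f1 by (simp add: v_def)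
    then show False using v0 \<open>i < N\<close> by simp
  qed
  then show ?thesis using fin by (auto simp: singular_graph_def cayley_graph_def)
qed

section \<open>Normal subgroups of the alternating group\<close>

abbreviation three_cycle :: "nat \<Rightarrow> nat \<Rightarrow> nat \<Rightarrow> nat \<Rightarrow> nat" where
  "three_cycle a b c \<equiv> transpose a b \<circ> transpose b c"

text \<open>The left side is the commutator of \<open>g\<close> with the 3-cycle (a b c) when
  \<open>g\<close> maps a to b, b to c and c to d.\<close>

lemma three_cycle_comp:
  assumes "distinct [a, b, c, d]"
  shows "three_cycle b c d \<circ> three_cycle c b a = three_cycle a d b"
proof
  fix z
  have ne: "a \<noteq> b" "a \<noteq> c" "a \<noteq> d" "b \<noteq> c" "b \<noteq> d" "c \<noteq> d" using assms by auto
  consider "z = a" | "z = b" | "z = c" | "z = d" | "z \<notin> {a, b, c, d}" by blast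
  then show "(three_cycle b c d \<circ> three_cycle c b a) z = three_cycle a d b z"
    by cases (use ne ne[symmetric] in \<open>simp_all add: transpose_def\<close>)
qed

lemma three_cycle_rotate:
  assumes "distinct [a, b, c]"
  shows "three_cycle c a b = three_cycle a b c"
proof
  fix z
  have ne: "a \<noteq> b" "a \<noteq> c" "b \<noteq> c" using assms by auto
  consider "z = a" | "z = b" | "z = c" | "z \<notin> {a, b, c}" by blast
  then show "three_cycle c a b z = three_cycle a b c z"
    by cases (use ne ne[symmetric] in \<open>simp_all add: transpose_def\<close>)
qed

lemma inv_three_cycle:
  assumes "distinct [a, b, c]"
  shows "inv' (three_cycle a b c) = three_cycle c b a"
proof -
  have "three_cycle a b c \<circ> three_cycle c b a = id" for a b c :: nat
    by (simp add: fun_eq_iff transpose_commute)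
  then show ?thesis by (intro inv_unique_comp)
qed

lemma three_cycle_mem_alt_group:
  assumes "a \<in> {1..n}" "b \<in> {1..n}" "c \<in> {1..n}" "a \<noteq> b" "b \<noteq> c"
  shows "three_cycle a b c \<in> carrier (alt_group n)"
  using assms by (simp add: alt_group_carrier permutes_compose permutes_swap_id evenperm_comp
      permutation_swap_id evenperm_swap)

lemma conjugate_three_cycle:
  assumes "bij s"
  shows "s \<circ> three_cycle a b c \<circ> inv' s = three_cycle (s a) (s b) (s c)"
proof -
  note com = comp_transpose[OF bij_is_inj[OF assms]]
  have "s \<circ> three_cycle a b c = three_cycle (s a) (s b) (s c) \<circ> s"
    using com[of a b] com[of b c] by (metis comp_assoc)
  then have "s \<circ> three_cycle a b c \<circ> inv' s = three_cycle (s a) (s b) (s c) \<circ> (s \<circ> inv' s)"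
    by (simp only: comp_assoc)
  also have "s \<circ> inv' s = id" using assms by (simp add: bij_is_surj flip: surj_iff)
  finally show ?thesis by (simp only: comp_id)
qed

text \<open>Label the three points 1, 2, 3 and all others 0. The two labellings have the same
  multiset of values, so a permutation carries one to the other and hence triple to triple.\<close>

lemma exists_permutes_triple:
  assumes A: "finite A" "{a, b, c} \<subseteq> A" "{a', b', c'} \<subseteq> A" and d: "distinct [a, b, c]" "distinct [a', b', c']"
  obtains s where "s permutes A" "s a = a'" "s b = b'" "s c = c'"
proof -
  define f where "f x y z w = (if w = x then 1 else if w = y then 2 else if w = z then 3 else 0 :: nat)" for x y z w :: 'a
  have "count (image_mset (f x y z) (mset_set A)) v =
      (if v \<in> {1, 2, 3} then 1 else if v = 0 then card A - 3 else 0)"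
    if "{x, y, z} \<subseteq> A" "distinct [x, y, z]" for x y z v
  proof -
    have eq: "count (image_mset (f x y z) (mset_set A)) v = card {w \<in> A. f x y z w = v}"
      using A(1) by (simp add: count_image_mset' eq_commute[of v])
    have "card (A - {x, y, z}) = card A - 3"
      using that A(1) by (simp add: card_Diff_subset)
    moreover have "{w \<in> A. f x y z w = 1} = {x}" "{w \<in> A. f x y z w = 2} = {y}" "{w \<in> A. f x y z w = 3} = {z}"
      "{w \<in> A. f x y z w = 0} = A - {x, y, z}"
      using that by (auto simp: f_def)
    moreover have "{w \<in> A. f x y z w = v} = {}" if "v \<notin> {0, 1, 2, 3}"
      using that by (auto simp: f_def)
    ultimately show ?thesis unfolding eq by (cases "v \<in> {0, 1, 2, 3}") (auto simp del: Collect_empty_eq)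
  qed
  then have "image_mset (f a b c) (mset_set A) = image_mset (f a' b' c') (mset_set A)"
    using A d by (intro multiset_eqI) simp
  then obtain s where s: "s permutes A" "\<forall>x\<in>A. f a b c x = f a' b' c' (s x)"
    using image_mset_eq_implies_permutes[OF A(1)] by blast
  have "f a b c a = 1" "f a b c b = 2" "f a b c c = 3" using d by (auto simp: f_def)
  then have "f a' b' c' (s a) = 1" "f a' b' c' (s b) = 2" "f a' b' c' (s c) = 3"
    using s(2)[THEN bspec, of a] s(2)[THEN bspec, of b] s(2)[THEN bspec, of c] A(2) by simp_all
  then have "s a = a'" "s b = b'" "s c = c'" by (auto simp: f_def split: if_splits)
  with s(1) that show ?thesis by blast
qed

text \<open>All 3-cycles are conjugate in the symmetric group, but for n = 4 not in the alternating
  group. If the conjugating \<open>s\<close> is odd, \<open>s \<circ> transpose a b\<close> is even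
  and yields the inverse of the wanted 3-cycle, which a subgroup contains as well.\<close>

lemma normal_subgroup_three_cycle:
  assumes K: "K \<lhd> alt_group n" and abc: "{a, b, c} \<subseteq> {1..n}" "distinct [a, b, c]" "three_cycle a b c \<in> K"
  shows "K = carrier (alt_group n)"
proof -
  interpret K: normal K "alt_group n" by (rule K)
  have Ksub: "K \<subseteq> carrier (alt_group n)" by (rule K.subset)
  have conj: "s \<circ> k \<circ> inv' s \<in> K" if "s \<in> carrier (alt_group n)" "k \<in> K" for s k
    using K.inv_op_closed2[OF that] that by (simp add: alt_group_mult alt_group_inv_equality)
  have inv: "inv' k \<in> K" if "k \<in> K" for k
    using subgroup.m_inv_closed[OF K.subgroup_axioms that] that Ksub by (auto simp: alt_group_inv_equality)
  have "three_cycle x y z \<in> K" if xyz: "{x, y, z} \<subseteq> {1..n}" "distinct [x, y, z]" for x y z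
  proof -
    obtain s where s: "s permutes {1..n}" "s a = x" "s b = y" "s c = z"
      using exists_permutes_triple[OF _ abc(1) xyz(1) abc(2) xyz(2)] by blast
    show ?thesis
    proof (cases "evenperm s")
      case True
      then have "s \<circ> three_cycle a b c \<circ> inv' s \<in> K"
        using s(1) abc(3) by (intro conj) (simp_all add: alt_group_carrier)
      then show ?thesis using s by (simp add: conjugate_three_cycle permutes_bij)
    next
      case False
      let ?s = "s \<circ> transpose a b"
      have sp: "?s permutes {1..n}" using s(1) abc(1) by (intro permutes_compose permutes_swap_id) auto
      moreover have "permutation s" using s(1) permutation_permutes by blast
      then have "evenperm ?s" using False abc(2) by (simp add: evenperm_comp permutation_swap_id evenperm_swap)
      ultimately have "?s \<circ> three_cycle a b c \<circ> inv' ?s \<in> K"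
        using abc(3) by (intro conj) (simp_all add: alt_group_carrier)
      moreover have "?s \<circ> three_cycle a b c \<circ> inv' ?s = three_cycle (?s a) (?s b) (?s c)"
        by (rule conjugate_three_cycle[OF permutes_bij[OF sp]])
      moreover have "?s a = y" "?s b = x" "?s c = z" using s(2-4) abc(2) by (auto simp: transpose_def)
      ultimately have "three_cycle y x z \<in> K" by simp
      then have "inv' (three_cycle y x z) \<in> K" by (rule inv)
      moreover have "distinct [y, x, z]" using xyz(2) by auto
      moreover have "three_cycle z x y = three_cycle x y z"
        using xyz(2) by (intro three_cycle_rotate) auto
      ultimately show ?thesis using inv_three_cycle[of y x z] by simp
    qed
  qed
  then have "three_cycles n \<subseteq> K"
    by (auto simp: length_Suc_conv numeral_3_eq_3)
  then have "generate (alt_group n) (three_cycles n) \<subseteq> K"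
    by (rule K.generate_subgroup_incl) (rule K.is_subgroup)
  then show ?thesis using Ksub alt_group_carrier_as_three_cycles by blast
qed

text \<open>The commutator of \<open>g\<close> with a 3-cycle along a long orbit of \<open>g\<close> is a 3-cycle.\<close>
lemma normal_subgroup_non_real:
  assumes K: "K \<lhd> alt_group n" and g: "g \<in> K" "\<not> real_element (alt_group n) g" and n: "4 \<le> n"
  shows "K = carrier (alt_group n)"
proof -
  interpret K: normal K "alt_group n" by (rule K)
  have gA: "g \<in> carrier (alt_group n)" using g(1) K.subset by blast
  interpret even_centraliser n g by (rule not_real_imp_even_centraliser[OF gA g(2)])
  have "\<exists>x\<in>{1..n}. g x \<noteq> x"
  proof (rule ccontr)
    assume "\<not> ?thesis"
    \<comment> \<open>Otherwise 1 and 2 would be two fixed points.\<close>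
    then have "(1::nat) = 2" using n by - (rule fixed_point_unique, auto)
    then show False by simp
  qed
  then obtain x where x: "x \<in> {1..n}" "g x \<noteq> x" by blast
  show ?thesis
  proof (cases "\<exists>x\<in>{1..n}. g x \<noteq> x \<and> g (g (g x)) \<noteq> x")
    case True
    then obtain a where a: "a \<in> {1..n}" "g a \<noteq> a" "g (g (g a)) \<noteq> a" by blast
    define b c d where bcd: "b = g a" "c = g (g a)" "d = g (g (g a))"
    have mem: "b \<in> {1..n}" "c \<in> {1..n}" "d \<in> {1..n}" using a(1) in_image by (simp_all only: bcd)
    have gv: "g a = b" "g b = c" "g c = d" by (simp_all add: bcd)
    have ne: "a \<noteq> b" "a \<noteq> c" "a \<noteq> d" using a no_2_cycle[OF a(1,2)] by (auto simp: bcd)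
    have ne': "b \<noteq> c" "b \<noteq> d" "c \<noteq> d" using ne gv inj_iff by metis+
    let ?h = "three_cycle a b c"
    have h: "?h \<in> carrier (alt_group n)" using a(1) mem ne ne' by (intro three_cycle_mem_alt_group)
    \<comment> \<open>Bracketed as \<open>g\<close> times a conjugate of \<open>inv' g\<close>, the
      commutator lies in \<open>K\<close>; bracketed as a conjugate of \<open>?h\<close> times
      \<open>inv' ?h\<close>, it is a product of two 3-cycles.\<close>
    have "?h \<circ> inv' g \<circ> inv' ?h \<in> K"
      using K.inv_op_closed2[OF h subgroup.m_inv_closed[OF K.subgroup_axioms g(1)]] h gA
      by (simp only: alt_group_mult alt_group_inv_equality)
    then have "g \<circ> (?h \<circ> inv' g \<circ> inv' ?h) \<in> K"
      using subgroup.m_closed[OF K.subgroup_axioms g(1)] by (simp only: alt_group_mult)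
    moreover have "g \<circ> (?h \<circ> inv' g \<circ> inv' ?h) = (g \<circ> ?h \<circ> inv' g) \<circ> inv' ?h"
      by (simp only: comp_assoc)
    moreover have "g \<circ> ?h \<circ> inv' g = three_cycle b c d"
      using conjugate_three_cycle[OF permutes_bij[OF perm], of a b c] gv by simp
    moreover have "inv' ?h = three_cycle c b a"
      using ne ne' by (intro inv_three_cycle) simp
    moreover have "three_cycle b c d \<circ> three_cycle c b a = three_cycle a d b"
      using ne ne' by (intro three_cycle_comp) simp
    ultimately have "three_cycle a d b \<in> K" by (simp only:)
    then show ?thesis
      using normal_subgroup_three_cycle[OF K, of a d b] a(1) mem ne ne' by simp
  next
    case False
    \<comment> \<open>Every moved point now lies on a 3-cycle, and there is only one, so
      \<open>g\<close> itself is a 3-cycle.\<close>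
    have x3: "g (g (g x)) = x" using False x by blast
    have other: "g z = z" if "z \<notin> {x, g x, g (g x)}" for z
    proof (cases "z \<in> {1..n}")
      case True
      show ?thesis
      proof (rule ccontr)
        assume "g z \<noteq> z"
        then show False using unique_3_cycle[OF x x3 True] False True that by blast
      qed
    next
      case False
      then show ?thesis by (rule permutes_not_in[OF perm])
    qed
    have ne: "g (g x) \<noteq> x" "g (g x) \<noteq> g x" using no_2_cycle[OF x] x by (auto simp: inj_iff)
    have "g = three_cycle x (g x) (g (g x))"
    proof
      fix z
      consider "z = x" | "z = g x" | "z = g (g x)" | "z \<notin> {x, g x, g (g x)}" by blast
      then show "g z = three_cycle x (g x) (g (g x)) z"
      proof cases
        case 4
        from other[OF this] 4 show ?thesis by (simp add: transpose_def)
      qed (use x(2) x3 ne ne[symmetric] in \<open>simp_all add: transpose_def\<close>)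
    qed
    moreover have "{x, g x, g (g x)} \<subseteq> {1..n}" using x(1) in_image[of x] in_image[of "g x"] by blast
    moreover have "distinct [x, g x, g (g x)]" using x(2) ne by auto
    ultimately show ?thesis using normal_subgroup_three_cycle[OF K] g(1) by metis
  qed
qed

lemma (in group) conj_invariantD:
  assumes M: "conj_invariant G M" and m: "m \<in> M"
  shows "m \<in> carrier G" and "g \<in> carrier G \<Longrightarrow> g \<otimes> m \<otimes> inv g \<in> M"
proof -
  obtain X where X: "X \<subseteq> carrier G" "M = (\<Union>x\<in>X. conj_class G x)"
    using M by (auto simp: conj_invariant_def)
  then obtain x where x: "x \<in> X" "x \<in> carrier G" "m \<in> conj_class G x" using m by blast
  then obtain k where k: "k \<in> carrier G" "m = k \<otimes> x \<otimes> inv k" by (auto simp: conj_class_eq)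
  show "m \<in> carrier G" using k x by simp
  show "g \<otimes> m \<otimes> inv g \<in> M" if g: "g \<in> carrier G"
  proof -
    have "g \<otimes> m \<otimes> inv g = (g \<otimes> k) \<otimes> x \<otimes> inv (g \<otimes> k)"
      using g k x by (simp add: inv_mult_group m_assoc)
    then have "g \<otimes> m \<otimes> inv g \<in> conj_class G x"
      using g k x(2) by (auto simp: conj_class_eq)
    then show ?thesis using X(2) x(1) by blast
  qed
qed

theorem theorem1p7:
  fixes n :: nat and M :: "(nat \<Rightarrow> nat) set"
  assumes "n \<ge> 4"
    and "M \<subseteq> {g \<in> carrier (alt_group n). \<not> real_element (alt_group n) g}"
  shows "(\<exists>\<chi>. irreducible_character (alt_group n) \<chi> \<and> (\<forall>g\<in>M. \<chi> g = 0)) \<and>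
         (M \<noteq> {} \<and> conj_invariant (alt_group n) M \<longrightarrow>
            connecting_set (alt_group n) (M \<union> set_inv\<^bsub>alt_group n\<^esub> M) \<and>
            singular_graph (cayley_graph (alt_group n) (M \<union> set_inv\<^bsub>alt_group n\<^esub> M)))"
proof (intro conjI impI)
  interpret group "alt_group n" by (rule alt_group_is_group)
  let ?A = "carrier (alt_group n)"
  let ?H = "M \<union> set_inv\<^bsub>alt_group n\<^esub> M"
  have M: "g \<in> ?A" "\<not> real_element (alt_group n) g" if "g \<in> M" for g using assms(2) that by auto
  obtain \<chi> where \<chi>: "irreducible_character (alt_group n) \<chi>"
    "\<And>g. g \<in> ?A \<Longrightarrow> \<not> real_element (alt_group n) g \<Longrightarrow> \<chi> g = 0"
    using irreducible_character_vanishing_on_non_real[OF assms(1)] by blast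
  then show "\<exists>\<chi>. irreducible_character (alt_group n) \<chi> \<and> (\<forall>g\<in>M. \<chi> g = 0)" using M by blast
  \<comment> \<open>Inverses of non-real elements are non-real, so the character vanishes on all of
    \<open>?H\<close>; the identity is real and thus excluded.\<close>
  have H: "h \<in> ?A" "\<not> real_element (alt_group n) h" if "h \<in> ?H" for h
    using that M real_element_inv by (auto simp: SET_INV_def)
  then have one: "\<one>\<^bsub>alt_group n\<^esub> \<notin> ?H" using real_element_one by blast
  assume "M \<noteq> {} \<and> conj_invariant (alt_group n) M"
  then obtain m where m: "m \<in> M" and inv: "conj_invariant (alt_group n) M" by blast
  have conj: "g \<otimes>\<^bsub>alt_group n\<^esub> h \<otimes>\<^bsub>alt_group n\<^esub> inv\<^bsub>alt_group n\<^esub> g \<in> ?H"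
    if g: "g \<in> ?A" and h: "h \<in> ?H" for g h
  proof (cases "h \<in> M")
    case True
    then show ?thesis using conj_invariantD(2)[OF inv _ g] by blast
  next
    case False
    then obtain k where k: "k \<in> M" "h = inv\<^bsub>alt_group n\<^esub> k" using h by (auto simp: SET_INV_def)
    have "g \<otimes>\<^bsub>alt_group n\<^esub> h \<otimes>\<^bsub>alt_group n\<^esub> inv\<^bsub>alt_group n\<^esub> g =
        inv\<^bsub>alt_group n\<^esub> (g \<otimes>\<^bsub>alt_group n\<^esub> k \<otimes>\<^bsub>alt_group n\<^esub> inv\<^bsub>alt_group n\<^esub> g)"
      using g k M(1) by (simp add: inv_mult_group m_assoc)
    then show ?thesis using conj_invariantD(2)[OF inv k(1) g] by (auto simp: SET_INV_def)
  qed
  have sub: "?H \<subseteq> ?A" using H(1) by blast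
  have "generate (alt_group n) ?H \<lhd> alt_group n" by (rule normal_generateI[OF sub conj])
  then have "generate (alt_group n) ?H = ?A"
    using m M(2) assms(1) by (intro normal_subgroup_non_real[of _ n m]) (auto intro: generate.incl)
  moreover have "?H = set_inv\<^bsub>alt_group n\<^esub> ?H"
    using M(1) by (force simp: SET_INV_def)
  ultimately show "connecting_set (alt_group n) ?H"
    using sub one by (simp add: connecting_set_def)
  show "singular_graph (cayley_graph (alt_group n) ?H)"
    by (rule singular_cayley_graph[OF finite_alt_group \<chi>(1) sub conj one \<chi>(2)[OF H]])
qed

end
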